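(* Let $\mathbf{x}\in\big((\Sigma_{n,2\mathbf{d}}^{\mathbf{g}})^*\big)^\circ$ and $\mathbf{s}\in\big(\Sigma_{n,2\mathbf{d}}^{\mathbf{g}}\big)^\circ$. Define the vector $\mathbf{w}=H(\mathbf{x})^{-1}\mathbf{s}$ and the matrices $\mathbf{S}_i=\Lambda_i(\mathbf{x})^{-1}\Lambda_i(\mathbf{w})\Lambda_i(\mathbf{x})^{-1}$ for $i=1,\ldots,m$. Then $\sum_{i=1}^m\Lambda_i^*(\mathbf{S}_i)=\mathbf{s}$. Furthermore, if $\big\|H(\mathbf{x})^{-1/2}(\mathbf{s}+\delta\nabla F(\mathbf{x}))\big\|<\delta$ for some $\delta>0$, then $\mathbf{S}_i$ is positive definite for $i=1,\ldots,m$.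
   Context: $\mathcal{V}_{n,r}$ is the space of real $n$-variate polynomials of total degree at most $r$; $\Sigma_{n,2d}\subset\mathcal{V}_{n,2d}$ is the set of finite sums of squares of polynomials in $\mathcal{V}_{n,d}$. Let $g_1,\ldots,g_m$ be nonzero real $n$-variate polynomials and $d_1,\ldots,d_m$ nonnegative integers; $\mathbf{g}=(g_1,\ldots,g_m)$, $\mathbf{d}=(d_1,\ldots,d_m)$. $\mathcal{V}_{n,2\mathbf{d}}^{\mathbf{g}}$ is the space of polynomials $\sum_{i=1}^m g_ir_i$ with $r_i\in\mathcal{V}_{n,2d_i}$, and $U=\dim\mathcal{V}_{n,2\mathbf{d}}^{\mathbf{g}}$, $L_i=\dim\mathcal{V}_{n,d_i}=\binom{n+d_i}{n}$. Fix an ordered basis $\mathbf{q}=(q_1,\ldots,q_U)$ of $\mathcal{V}_{n,2\mathbf{d}}^{\mathbf{g}}$ and ordered bases $\mathbf{p}_i=(p_{i,1},\ldots,p_{i,L_i})$ of $\mathcal{V}_{n,d_i}$. $\Sigma_{n,2\mathbf{d}}^{\mathbf{g}}\subset\mathbb{R}^U$ is the cone of coefficient vectors (in the basis $\mathbf{q}$) of polynomials of the form $\sum_{i=1}^m g_is_i$ with $s_i\in\Sigma_{n,2d_i}$, and $(\Sigma_{n,2\mathbf{d}}^{\mathbf{g}})^*=\{\mathbf{x}\in\mathbb{R}^U:\mathbf{s}^{\mathrm T}\mathbf{x}\ge0\ \forall\,\mathbf{s}\in\Sigma_{n,2\mathbf{d}}^{\mathbf{g}}\}$ is its dual cone; $\mathcal{C}^\circ$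 denotes the interior of $\mathcal{C}$. $\mathbb{S}^{L}$ is the space of real symmetric $L\times L$ matrices with the Frobenius inner product $\bullet$. $\Lambda_i:\mathbb{R}^U\to\mathbb{S}^{L_i}$ is the unique linear map with $\Lambda_i(\mathbf{q})=g_i\mathbf{p}_i\mathbf{p}_i^{\mathrm T}$, i.e. $\Lambda_i(\mathbf{x})=\sum_u x_u\mathbf{E}_{iu}$ where $g_ip_{i,j}p_{i,k}=\sum_u(\mathbf{E}_{iu})_{jk}q_u$ as polynomials for all $j,k$; its adjoint is $\Lambda_i^*(\mathbf{S})=(\mathbf{E}_{iu}\bullet\mathbf{S})_{u=1,\ldots,U}$. It is known that $(\Sigma_{n,2\mathbf{d}}^{\mathbf{g}})^*=\{\mathbf{x}:\Lambda_i(\mathbf{x})\succeq0,\ i=1,\ldots,m\}$. $F(\mathbf{x})=-\sum_{i=1}^m\ln(\det(\Lambda_i(\mathbf{x})))$ on the interior of the dual cone, with gradient $\nabla F(\mathbf{x})$ and Hessian $H(\mathbf{x})=\nabla^2F(\mathbf{x})$. $\|\cdot\|$ is the Euclidean norm. *)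

theory Defs
  imports
    "HOL-Analysis.Analysis"
    "HOL-Analysis.Finite_Function_Topology"
    "Jordan_Normal_Form.Determinant"
    "Jordan_Normal_Form.Gauss_Jordan_Elimination"
begin

text \<open>
  Both HOL-Analysis and Jordan_Normal_Form are needed: vectors of coefficients live in
  \<open>real ^ 'u\<close> (which carries the topology and the differential calculus), whereas the matrices
  whose order depends on an index \<open>i\<close> are matrices with explicit dimensions. The infix
  symbol \<open>$\<close> is reserved for \<open>real ^ 'u\<close> and the inner product symbol is avoided altogether.
\<close>

no_notation vec_index (infixl \<open>$\<close> 100)


subsection \<open>Polynomials\<close>

text \<open>
  A polynomial is a finitely supported function from monomials to real coefficients, multiplied by
  convolution; the variables are numbered by natural numbers.
\<close>

type_synonym mpoly = "(nat \<Rightarrow>\<^sub>0 nat) \<Rightarrow>\<^sub>0 real"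

definition mon_degree :: "(nat \<Rightarrow>\<^sub>0 nat) \<Rightarrow> nat" where
  "mon_degree a = (\<Sum>v\<in>Poly_Mapping.keys a. Poly_Mapping.lookup a v)"

definition polys :: "nat \<Rightarrow> mpoly set" where
  "polys n = {f. \<forall>a\<in>Poly_Mapping.keys f. Poly_Mapping.keys a \<subseteq> {..<n}}"

definition polys_deg :: "nat \<Rightarrow> nat \<Rightarrow> mpoly set" where
  "polys_deg n r = {f \<in> polys n. \<forall>a\<in>Poly_Mapping.keys f. mon_degree a \<le> r}"

text \<open>The argument \<open>d\<close> bounds the degree of the polynomials being squared.\<close>

definition sos :: "nat \<Rightarrow> nat \<Rightarrow> mpoly set" where
  "sos n d = {(\<Sum>k<N. (f k)\<^sup>2) | (N :: nat) f. \<forall>k<N. f k \<in> polys_deg n d}"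

definition weighted_polys :: "nat \<Rightarrow> nat \<Rightarrow> (nat \<Rightarrow> mpoly) \<Rightarrow> (nat \<Rightarrow> nat) \<Rightarrow> mpoly set" where
  "weighted_polys n m g d = {(\<Sum>i<m. g i * r i) | r. \<forall>i<m. r i \<in> polys_deg n (2 * d i)}"

definition weighted_sos :: "nat \<Rightarrow> nat \<Rightarrow> (nat \<Rightarrow> mpoly) \<Rightarrow> (nat \<Rightarrow> nat) \<Rightarrow> mpoly set" where
  "weighted_sos n m g d = {(\<Sum>i<m. g i * s i) | s. \<forall>i<m. s i \<in> sos n (d i)}"


subsection \<open>Bases and coefficient vectors\<close>

definition basis_family :: "'i set \<Rightarrow> ('i \<Rightarrow> 'v::real_vector) \<Rightarrow> 'v set \<Rightarrow> bool" where
  "basis_family I b V \<longleftrightarrow> inj_on b I \<and> independent (b ` I) \<and> span (b ` I) = V"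

definition coeff_vec :: "('u::finite \<Rightarrow> mpoly) \<Rightarrow> mpoly \<Rightarrow> real ^ 'u" where
  "coeff_vec q f = (\<chi> u. representation (range q) f (q u))"

definition sos_cone ::
  "nat \<Rightarrow> nat \<Rightarrow> (nat \<Rightarrow> mpoly) \<Rightarrow> (nat \<Rightarrow> nat) \<Rightarrow> ('u::finite \<Rightarrow> mpoly) \<Rightarrow> (real ^ 'u) set" where
  "sos_cone n m g d q = coeff_vec q ` weighted_sos n m g d"

definition dual_cone :: "'v::real_inner set \<Rightarrow> 'v set" where
  "dual_cone C = {x. \<forall>s\<in>C. inner s x \<ge> 0}"


subsection \<open>Matrices with explicit dimensions\<close>

definition pos_def_mat :: "nat \<Rightarrow> real mat \<Rightarrow> bool" where
  "pos_def_mat L A \<longleftrightarrow> A \<in> carrier_mat L L \<and> transpose_mat A = A \<and>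
     (\<forall>v\<in>carrier_vec L. v \<noteq> 0\<^sub>v L \<longrightarrow> scalar_prod v (A *\<^sub>v v) > 0)"

definition frobenius :: "real mat \<Rightarrow> real mat \<Rightarrow> real" where
  "frobenius A B = (\<Sum>j<dim_row A. \<Sum>k<dim_col A. A $$ (j, k) * B $$ (j, k))"

abbreviation inv_mat :: "real mat \<Rightarrow> real mat" where
  "inv_mat A \<equiv> the (mat_inverse A)"


subsection \<open>The operators and their adjoints\<close>

text \<open>
  The argument \<open>L\<close> is the length of the ordered basis \<open>p 0, ..., p (L - 1)\<close> and \<open>g\<close> is a single
  weight.
\<close>

definition E_mat ::
  "('u::finite \<Rightarrow> mpoly) \<Rightarrow> mpoly \<Rightarrow> nat \<Rightarrow> (nat \<Rightarrow> mpoly) \<Rightarrow> 'u \<Rightarrow> real mat" where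
  "E_mat q g L p u = Matrix.mat L L (\<lambda>(j, k). coeff_vec q (g * p j * p k) $ u)"

definition Lam ::
  "('u::finite \<Rightarrow> mpoly) \<Rightarrow> mpoly \<Rightarrow> nat \<Rightarrow> (nat \<Rightarrow> mpoly) \<Rightarrow> real ^ 'u \<Rightarrow> real mat" where
  "Lam q g L p x = Matrix.mat L L (\<lambda>(j, k). \<Sum>u\<in>UNIV. x $ u * E_mat q g L p u $$ (j, k))"

definition Lam_adj ::
  "('u::finite \<Rightarrow> mpoly) \<Rightarrow> mpoly \<Rightarrow> nat \<Rightarrow> (nat \<Rightarrow> mpoly) \<Rightarrow> real mat \<Rightarrow> real ^ 'u" where
  "Lam_adj q g L p S = (\<chi> u. frobenius (E_mat q g L p u) S)"

text \<open>
  Outside the interior of the dual cone the values of the following function are irrelevant: that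
  interior is open, so the derivatives there do not depend on them.
\<close>

definition barrier ::
  "nat \<Rightarrow> (nat \<Rightarrow> mpoly) \<Rightarrow> (nat \<Rightarrow> nat) \<Rightarrow> ('u::finite \<Rightarrow> mpoly) \<Rightarrow> (nat \<Rightarrow> nat \<Rightarrow> mpoly)
     \<Rightarrow> real ^ 'u \<Rightarrow> real" where
  "barrier m g L q p x = - (\<Sum>i<m. ln (Determinant.det (Lam q (g i) (L i) (p i) x)))"


subsection \<open>Gradient, Hessian and matrix square root\<close>

definition gradient :: "('v::real_inner \<Rightarrow> real) \<Rightarrow> 'v \<Rightarrow> 'v" where
  "gradient f x = (THE D. GDERIV f x :> D)"

definition hessian :: "(real ^ 'u::finite \<Rightarrow> real) \<Rightarrow> real ^ 'u \<Rightarrow> real ^ 'u ^ 'u" where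
  "hessian f x = matrix (frechet_derivative (gradient f) (at x))"

definition pos_semidef :: "real ^ 'u ^ 'u::finite \<Rightarrow> bool" where
  "pos_semidef A \<longleftrightarrow> Finite_Cartesian_Product.transpose A = A \<and> (\<forall>v. inner v (A *v v) \<ge> 0)"

definition matrix_sqrt :: "real ^ 'u ^ 'u::finite \<Rightarrow> real ^ 'u ^ 'u" where
  "matrix_sqrt A = (THE R. pos_semidef R \<and> R ** R = A)"

end

theory Submission
  imports Defs
begin

text \<open>
  Write \<open>M i\<close> for the positive definite matrix \<open>Lam i x\<close> and \<open>N i\<close> for its inverse. Jacobi's formula
  and the derivative of the inverse give \<open>gradient F x = - (\<Sum>i. Lam_adj i (N i))\<close> and
  \<open>H w = (\<Sum>i. Lam_adj i (N i * Lam i w * N i))\<close>. The first claim is therefore \<open>H w = s\<close>, and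
  moreover \<open>gradient F x = - H x\<close>. With a factorization \<open>N i = K\<^sup>T K\<close>, the quadratic form of \<open>H\<close> at \<open>y\<close>
  is the sum of the squared Frobenius norms of \<open>K (Lam i y) K\<^sup>T\<close>. It vanishes only if \<open>y\<close> is
  orthogonal to the cone, which has interior points; so \<open>H\<close> is positive definite. For
  \<open>y = w - \<delta> x\<close> one has \<open>H y = s + \<delta> gradient F x\<close>, so the hypothesis says that every
  \<open>K (Lam i w) K\<^sup>T\<close> is at Frobenius distance less than \<open>\<delta>\<close> from \<open>\<delta>\<close> times the identity, hence
  positive definite; and \<open>S i\<close> is congruent to it.
\<close>

subsection \<open>Symmetric square roots\<close>

text \<open>A maximizer \<open>v\<close> of the Rayleigh quotient on the unit sphere of
  \<open>V\<close> is an eigenvector: moving from \<open>v\<close> along the residual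
  \<open>f v - c v\<close> would otherwise raise the quotient to first order.\<close>

lemma symmetric_maximal_eigenvector:
  fixes f :: "'a::euclidean_space \<Rightarrow> 'a"
  assumes f: "linear f" and sym: "\<And>x y. inner (f x) y = inner x (f y)"
    and V: "subspace V" and inv: "f ` V \<subseteq> V" and nz: "V \<noteq> {0}"
  obtains v c where "v \<in> V" "norm v = 1" "f v = c *\<^sub>R v"
proof -
  define K where "K = V \<inter> sphere 0 1"
  have compact: "compact K"
    unfolding K_def using closed_subspace[OF V] by (intro closed_Int_compact) auto
  obtain v0 where v0: "v0 \<in> V" "v0 \<noteq> 0"
    using nz subspace_0[OF V] by auto
  then have "(1 / norm v0) *\<^sub>R v0 \<in> K"
    unfolding K_def using subspace_mul[OF V] by auto
  then have nonempty: "K \<noteq> {}" by auto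
  have "continuous_on K (\<lambda>x. inner x (f x))"
    by (intro continuous_intros linear_continuous_on linear_conv_bounded_linear[THEN iffD1] f)
  from continuous_attains_sup[OF compact nonempty this]
  obtain v where v: "v \<in> K" and max: "\<And>y. y \<in> K \<Longrightarrow> inner y (f y) \<le> inner v (f v)" by auto
  define c where "c = inner v (f v)"
  have vV: "v \<in> V" and nv: "norm v = 1" using v by (auto simp: K_def)
  then have vv: "inner v v = 1" by (simp add: norm_eq_1)
  \<comment> \<open>Homogeneity extends the maximality from the sphere to all of
    \<open>V\<close>.\<close>
  have bound: "inner y (f y) \<le> c * inner y y" if "y \<in> V" for y
  proof (cases "y = 0")
    case False
    define z where "z = (1 / norm y) *\<^sub>R y"
    have "z \<in> K" using False that subspace_mul[OF V] by (auto simp: K_def z_def)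
    from max[OF this] have "inner y (f y) / (norm y)\<^sup>2 \<le> c"
      by (simp add: z_def c_def linear_scale[OF f] power2_eq_square)
    then show ?thesis
      using False by (simp add: divide_le_eq dot_square_norm)
  qed (simp add: linear_0[OF f])
  define u where "u = f v - c *\<^sub>R v"
  have uV: "u \<in> V"
    unfolding u_def using inv vV by (intro subspace_diff[OF V] subspace_mul[OF V]) auto
  have uv: "inner u v = 0"
    by (simp add: u_def inner_diff_left c_def vv inner_commute[of "f v"])
  have ufv: "inner u (f v) = inner u u"
    using uv by (simp add: u_def inner_diff_left inner_diff_right inner_commute)
  define b where "b = c * inner u u - inner u (f u)"
  have key: "2 * t * inner u u \<le> t\<^sup>2 * b" for t
  proof -
    have "v + t *\<^sub>R u \<in> V" by (intro subspace_add[OF V] subspace_mul[OF V] vV uV)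
    from bound[OF this]
    have "c + 2 * t * inner u (f v) + t\<^sup>2 * inner u (f u) \<le> c * (1 + t\<^sup>2 * inner u u)"
      using uv sym[of v u]
      by (simp add: linear_add[OF f] linear_scale[OF f] inner_add_left inner_add_right vv c_def
          inner_commute power2_eq_square algebra_simps)
    then show ?thesis unfolding ufv b_def by (simp add: algebra_simps)
  qed
  have "inner u u = 0"
  proof (rule ccontr)
    assume "inner u u \<noteq> 0"
    then have pos: "inner u u > 0" using inner_ge_zero[of u] by linarith
    \<comment> \<open>Small enough that the quadratic term in \<open>key\<close> cannot absorb the
      linear one; the \<open>+ 1\<close> keeps the denominator positive when
      \<open>b = 0\<close>.\<close>
    define t where "t = inner u u / (\<bar>b\<bar> + 1)"
    have t: "t > 0" using pos by (simp add: t_def)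
    have "2 * inner u u \<le> t * b" using key[of t] t by (simp add: power2_eq_square)
    also have "\<dots> \<le> t * (\<bar>b\<bar> + 1)" using t by (intro mult_left_mono) auto
    also have "\<dots> = inner u u" by (simp add: t_def)
    finally show False using pos by simp
  qed
  then have "f v = c *\<^sub>R v" by (simp add: u_def)
  with vV nv show thesis by (rule that)
qed

text \<open>Induction on the dimension: after a unit eigenvector is split off, symmetry keeps its
  orthogonal complement in \<open>V\<close> invariant. The invariant subspace \<open>V\<close> is a
  parameter so that the induction hypothesis applies to this complement.\<close>

lemma symmetric_orthonormal_eigenbasis:
  fixes f :: "'a::euclidean_space \<Rightarrow> 'a"
  assumes f: "linear f" and sym: "\<And>x y. inner (f x) y = inner x (f y)"
    and V: "subspace V" and inv: "f ` V \<subseteq> V"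
  obtains B where "finite B" "\<And>b b'. b \<in> B \<Longrightarrow> b' \<in> B \<Longrightarrow> inner b b' = (if b = b' then 1 else 0)"
    "span B = V" "\<And>b. b \<in> B \<Longrightarrow> \<exists>c. f b = c *\<^sub>R b"
proof -
  have "\<exists>B. finite B \<and> (\<forall>b\<in>B. \<forall>b'\<in>B. inner b b' = (if b = b' then 1 else 0)) \<and> span B = V
      \<and> (\<forall>b\<in>B. \<exists>c. f b = c *\<^sub>R b)"
    using V inv
  proof (induction "dim V" arbitrary: V rule: less_induct)
    case less
    show ?case
    proof (cases "V = {0}")
      case True
      then show ?thesis by (intro exI[of _ "{}"]) auto
    next
      case False
      from symmetric_maximal_eigenvector[OF f sym less.prems False]
      obtain v c where v: "v \<in> V" "norm v = 1" "f v = c *\<^sub>R v" .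
      have vv: "inner v v = 1" using v(2) by (simp add: norm_eq_1)
      define W where "W = {u \<in> V. inner u v = 0}"
      have W: "subspace W"
        using less.prems(1) unfolding W_def subspace_def by (auto simp: inner_add_left)
      have invW: "f ` W \<subseteq> W"
        using less.prems(2) sym[of _ v] v(3) by (auto simp: W_def)
      have "dim W < dim V"
      proof (rule dim_psubset)
        have "v \<notin> W" using vv by (simp add: W_def)
        then have "W \<subset> V" using v(1) unfolding W_def by blast
        then show "span W \<subset> span V" using W less.prems(1) by (simp add: span_eq_iff[THEN iffD2])
      qed
      from less.hyps[OF this W invW] obtain B where
        B: "finite B" "\<forall>b\<in>B. \<forall>b'\<in>B. inner b b' = (if b = b' then 1 else 0)" "span B = W"
          "\<forall>b\<in>B. \<exists>c. f b = c *\<^sub>R b"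
        by blast
      have BW: "b \<in> W" if "b \<in> B" for b using B(3) that span_base by blast
      have "span (insert v B) = V"
      proof
        show "span (insert v B) \<subseteq> V"
          using v(1) BW less.prems(1) by (intro span_minimal) (auto simp: W_def)
        show "V \<subseteq> span (insert v B)"
        proof
          fix x assume x: "x \<in> V"
          have "x - inner x v *\<^sub>R v \<in> W"
            using x v(1) less.prems(1) vv
            by (auto simp: W_def inner_diff_left intro!: subspace_diff subspace_mul)
          then have "x - inner x v *\<^sub>R v \<in> span B" using B(3) by simp
          then show "x \<in> span (insert v B)" using span_breakdown_eq by blast
        qed
      qed
      moreover have "inner b b' = (if b = b' then 1 else 0)"
        if "b \<in> insert v B" "b' \<in> insert v B" for b b'
        using that B(2) BW vv by (auto simp: W_def inner_commute)
      ultimately show ?thesis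
        using B v by (intro exI[of _ "insert v B"]) auto
    qed
  qed
  then show thesis using that by blast
qed

lemma transpose_eq_imp_inner_symmetric:
  fixes A :: "real ^ 'u ^ 'u::finite"
  assumes "Finite_Cartesian_Product.transpose A = A"
  shows "inner (A *v x) y = inner x (A *v y)"
  using assms dot_lmul_matrix[of x A y] transpose_matrix_vector[of A x] by simp

lemma inner_symmetric_imp_transpose_eq:
  fixes A :: "real ^ 'u ^ 'u::finite"
  assumes "\<And>x y. inner (A *v x) y = inner x (A *v y)"
  shows "Finite_Cartesian_Product.transpose A = A"
proof -
  have "A $ j $ i = A $ i $ j" for i j
    using assms[of "axis i 1" "axis j 1"]
    by (simp add: matrix_vector_mult_basis inner_axis inner_axis' column_def)
  then show ?thesis by (simp add: vec_eq_iff transpose_def)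
qed

text \<open>A semidefinite root must act on every eigenvector of \<open>A\<close> as multiplication
  by the root of the eigenvalue, so two such roots agree on a spanning set.\<close>

lemma pos_semidef_eq_if_square_eq:
  fixes A :: "real ^ 'u ^ 'u::finite"
  assumes R: "pos_semidef R" "R ** R = A" and Q: "pos_semidef Q" "Q ** Q = A"
  shows "R = Q"
proof -
  have symR: "inner (R *v x) y = inner x (R *v y)" for x y
    using R(1) by (simp add: pos_semidef_def transpose_eq_imp_inner_symmetric)
  have "inner (A *v x) y = inner x (A *v y)" for x y
    unfolding R(2)[symmetric] by (simp add: matrix_vector_mul_assoc[symmetric] symR)
  from symmetric_orthonormal_eigenbasis[OF matrix_vector_mul_linear this subspace_UNIV]
  obtain B where B: "span B = UNIV" "\<And>b. b \<in> B \<Longrightarrow> \<exists>c. A *v b = c *\<^sub>R b"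
    by (metis subset_UNIV)
  have root: "P *v b = sqrt c *\<^sub>R b"
    if P: "pos_semidef P" "P ** P = A" and b: "A *v b = c *\<^sub>R b" for P b c
  proof (cases "b = 0")
    case False
    have sym: "inner (P *v x) y = inner x (P *v y)" for x y
      using P(1) by (simp add: pos_semidef_def transpose_eq_imp_inner_symmetric)
    have PP: "P *v (P *v b) = c *\<^sub>R b"
      using P(2) b by (simp add: matrix_vector_mul_assoc)
    have eq: "inner (P *v b) (P *v b) = c * inner b b"
      using PP by (simp add: sym)
    have "0 \<le> c * inner b b" unfolding eq[symmetric] by simp
    then have c: "c \<ge> 0"
      using False inner_gt_zero_iff[of b] by (metis not_le mult_neg_pos)
    \<comment> \<open>Factoring \<open>P ** P - c\<close> as a product of \<open>P + sqrt c\<close>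
      and \<open>P - sqrt c\<close> shows that \<open>P\<close> maps this residual to
      \<open>- sqrt c\<close> times itself. Semidefiniteness allows that only if
      \<open>c = 0\<close> or \<open>u = 0\<close>.\<close>
    define u where "u = P *v b - sqrt c *\<^sub>R b"
    have Pu: "P *v u = - (sqrt c *\<^sub>R u)"
      using c by (simp add: u_def matrix_vector_mult_diff_distrib PP matrix_vector_mult_scaleR
          scaleR_diff_right)
    have "inner u (P *v u) \<ge> 0" using P(1) by (simp add: pos_semidef_def)
    then have "sqrt c * inner u u \<le> 0" unfolding Pu by simp
    then have "c = 0 \<or> u = 0"
      using c inner_gt_zero_iff[of u] by (metis antisym_conv2 mult_pos_pos not_le
          real_sqrt_gt_0_iff order.order_iff_strict)
    then show ?thesis
    proof
      assume "c = 0"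
      then show ?thesis using eq by simp
    qed (simp add: u_def)
  qed simp
  have "R *v x = Q *v x" for x
  proof (rule linear_eq_on[where B = B and f = "(*v) R" and g = "(*v) Q"])
    show "linear ((*v) R)" "linear ((*v) Q)" by (rule matrix_vector_mul_linear)+
    show "x \<in> span B" using B by simp
    fix b assume "b \<in> B"
    with B(2) root R Q show "R *v b = Q *v b" by metis
  qed
  then show ?thesis by (simp add: matrix_eq)
qed

text \<open>Spectral construction: the orthonormal eigenbasis of \<open>A\<close> is kept and each
  eigenvalue, nonnegative by semidefiniteness, is replaced by its root.\<close>

lemma pos_semidef_root_exists:
  fixes A :: "real ^ 'u ^ 'u::finite"
  assumes A: "pos_semidef A"
  shows "\<exists>R. pos_semidef R \<and> R ** R = A"
proof -
  have sym: "inner (A *v x) y = inner x (A *v y)" for x y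
    using A by (simp add: pos_semidef_def transpose_eq_imp_inner_symmetric)
  from symmetric_orthonormal_eigenbasis[OF matrix_vector_mul_linear this subspace_UNIV]
  obtain B where B: "finite B" "span B = (UNIV :: (real ^ 'u) set)"
    and ortho: "\<And>b b'. b \<in> B \<Longrightarrow> b' \<in> B \<Longrightarrow> inner b b' = (if b = b' then 1 else 0)"
    and "\<And>b. b \<in> B \<Longrightarrow> \<exists>c. A *v b = c *\<^sub>R b"
    by (metis subset_UNIV)
  then obtain c where c: "\<And>b. b \<in> B \<Longrightarrow> A *v b = c b *\<^sub>R b" by metis
  have c_nonneg: "c b \<ge> 0" if "b \<in> B" for b
  proof -
    have "inner b (A *v b) \<ge> 0" using A by (simp add: pos_semidef_def)
    then show ?thesis using c[OF that] ortho[OF that that] by simp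
  qed
  define f where "f x = (\<Sum>b\<in>B. (sqrt (c b) * inner b x) *\<^sub>R b)" for x
  have f: "linear f"
    unfolding f_def
    by (intro linearI)
      (simp_all add: inner_add_right algebra_simps sum.distrib scaleR_sum_right)
  have fb: "f b = sqrt (c b) *\<^sub>R b" if "b \<in> B" for b
  proof -
    have "f b = (\<Sum>b'\<in>B. if b' = b then sqrt (c b) *\<^sub>R b else 0)"
      unfolding f_def using that by (intro sum.cong) (auto simp: ortho)
    then show ?thesis using that B(1) by simp
  qed
  define R where "R = matrix f"
  have Rf: "R *v x = f x" for x unfolding R_def using f by (simp add: matrix_works linear_matrix_vector_mul_eq)
  have "(R ** R) *v x = A *v x" for x
  proof (rule linear_eq_on[where B = B and f = "(*v) (R ** R)" and g = "(*v) A"])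
    show "x \<in> span B" using B by simp
    fix b assume b: "b \<in> B"
    show "(R ** R) *v b = A *v b"
      using b c_nonneg[OF b]
      by (simp add: matrix_vector_mul_assoc[symmetric] Rf fb linear_scale[OF f] c)
  qed (rule matrix_vector_mul_linear)+
  then have "R ** R = A" by (simp add: matrix_eq)
  moreover have "Finite_Cartesian_Product.transpose R = R"
    by (rule inner_symmetric_imp_transpose_eq)
      (simp add: Rf f_def inner_sum_left inner_sum_right inner_commute mult_ac)
  moreover have "inner v (R *v v) \<ge> 0" for v
    unfolding Rf f_def inner_sum_right
    by (intro sum_nonneg)
      (auto simp: inner_commute[of v] mult.assoc c_nonneg intro!: mult_nonneg_nonneg)
  ultimately show ?thesis by (auto simp: pos_semidef_def)
qed

text \<open>Existence and uniqueness of the root give the definite description behind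
  \<open>matrix_sqrt\<close> its intended value.\<close>

lemma matrix_sqrt:
  fixes A :: "real ^ 'u ^ 'u::finite"
  assumes "pos_semidef A"
  shows "pos_semidef (matrix_sqrt A)" and "matrix_sqrt A ** matrix_sqrt A = A"
proof -
  have "\<exists>!R. pos_semidef R \<and> R ** R = A"
    using pos_semidef_root_exists[OF assms] pos_semidef_eq_if_square_eq by blast
  from theI'[OF this] show "pos_semidef (matrix_sqrt A)" "matrix_sqrt A ** matrix_sqrt A = A"
    by (simp_all add: matrix_sqrt_def)
qed

text \<open>Applied to the inverse Hessian, this turns the norm in the hypothesis on
  \<open>\<delta>\<close> into a quadratic form free of square roots.\<close>

lemma norm_matrix_sqrt:
  fixes A :: "real ^ 'u ^ 'u::finite"
  assumes "pos_semidef A"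
  shows "(norm (matrix_sqrt A *v z))\<^sup>2 = inner z (A *v z)"
proof -
  let ?R = "matrix_sqrt A"
  have "Finite_Cartesian_Product.transpose ?R = ?R"
    using matrix_sqrt(1)[OF assms] by (simp add: pos_semidef_def)
  then have "inner (?R *v z) (?R *v z) = inner z ((?R ** ?R) *v z)"
    by (simp add: transpose_eq_imp_inner_symmetric matrix_vector_mul_assoc)
  then show ?thesis by (simp add: matrix_sqrt(2)[OF assms] power2_norm_eq_inner)
qed

subsection \<open>Positive definite matrices\<close>

text \<open>Induction on the order: the Schur complement \<open>a'\<close> of the last diagonal
  entry is again symmetric and positive definite. Entries are given by a function of two indices, so
  passing to the leading block only lowers \<open>n\<close>.\<close>

lemma cholesky:
  fixes a :: "nat \<Rightarrow> nat \<Rightarrow> real"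
  assumes "\<And>j k. j < n \<Longrightarrow> k < n \<Longrightarrow> a j k = a k j"
    and "\<And>v. \<exists>j<n. v j \<noteq> 0 \<Longrightarrow> (\<Sum>j<n. \<Sum>k<n. v j * a j k * v k) > 0"
  shows "\<exists>c. \<forall>j<n. \<forall>k<n. a j k = (\<Sum>l<n. c j l * c k l)"
  using assms
proof (induction n arbitrary: a)
  case (Suc n)
  note sym = Suc.prems(1) and pos = Suc.prems(2)
  define t where "t = a n n"
  have t: "t > 0"
  proof -
    \<comment> \<open>The form is tested on the last unit vector.\<close>
    have "0 < (\<Sum>j<Suc n. \<Sum>k<Suc n. of_bool (j = n) * a j k * of_bool (k = n))"
      by (rule pos) auto
    also have "\<dots> = t" by (simp add: t_def)
    finally show ?thesis .
  qed
  define a' where "a' j k = a j k - a j n * a k n / t" for j k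
  have "\<exists>c. \<forall>j<n. \<forall>k<n. a' j k = (\<Sum>l<n. c j l * c k l)"
  proof (rule Suc.IH)
    show "a' j k = a' k j" if "j < n" "k < n" for j k
      using that sym by (simp add: a'_def mult.commute)
    fix v :: "nat \<Rightarrow> real" assume v: "\<exists>j<n. v j \<noteq> 0"
    define b where "b = (\<Sum>j<n. v j * a j n)"
    \<comment> \<open>The last coordinate \<open>- b / t\<close> minimizes the form of
      \<open>a\<close> over all extensions of \<open>v\<close>; the minimum is the form of the Schur
      complement at \<open>v\<close>.\<close>
    define u where "u = v(n := - b / t)"
    have uv: "u j = v j" if "j < n" for j using that by (simp add: u_def)
    define Q where "Q = (\<Sum>j<n. \<Sum>k<n. v j * a j k * v k)"
    have "0 < (\<Sum>j<Suc n. \<Sum>k<Suc n. u j * a j k * u k)"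
      using v by (intro pos) (auto simp: u_def)
    also have "\<dots> = Q + b * u n + ((\<Sum>k<n. u n * a n k * v k) + u n * t * u n)"
    proof -
      have "(\<Sum>j<n. \<Sum>k<n. u j * a j k * u k) = Q"
        "(\<Sum>j<n. u j * a j n * u n) = b * u n"
        "(\<Sum>k<n. u n * a n k * u k) = (\<Sum>k<n. u n * a n k * v k)"
        by (simp_all add: uv Q_def b_def sum_distrib_right)
      then show ?thesis by (simp add: t_def sum.distrib)
    qed
    also have "(\<Sum>k<n. u n * a n k * v k) = u n * b"
      unfolding b_def sum_distrib_left by (intro sum.cong) (auto simp: sym[of n] mult_ac)
    also have "Q + b * u n + (u n * b + u n * t * u n) = Q - b * b / t"
      using t by (simp add: u_def field_simps)
    also have "b * b / t = (\<Sum>j<n. \<Sum>k<n. v j * (a j n * a k n / t) * v k)"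
      unfolding b_def sum_product sum_divide_distrib by (intro sum.cong) (auto simp: mult_ac)
    also have "Q - \<dots> = (\<Sum>j<n. \<Sum>k<n. v j * a' j k * v k)"
      unfolding Q_def sum_subtractf[symmetric] by (intro sum.cong) (auto simp: a'_def algebra_simps)
    finally show "0 < (\<Sum>j<n. \<Sum>k<n. v j * a' j k * v k)" .
  qed
  then obtain c where c: "\<And>j k. j < n \<Longrightarrow> k < n \<Longrightarrow> a' j k = (\<Sum>l<n. c j l * c k l)" by blast
  \<comment> \<open>The new last column contributes exactly the rank-one term that was subtracted in
    \<open>a'\<close>; the zeros in row \<open>n\<close> keep the old factor confined to the leading
    block.\<close>
  define c' where "c' j l = (if l = n then a j n / sqrt t else if j = n then 0 else c j l)" for j l
  have tt: "sqrt t * sqrt t = t" using t by simp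
  have "a j k = (\<Sum>l<Suc n. c' j l * c' k l)" if jk: "j < Suc n" "k < Suc n" for j k
  proof -
    have "(\<Sum>l<Suc n. c' j l * c' k l)
        = (if j = n \<or> k = n then 0 else (\<Sum>l<n. c j l * c k l)) + a j n * a k n / t"
      using tt by (simp add: c'_def)
    also have "\<dots> = a j k"
      using jk t sym[of n k] c[of j k] by (auto simp: less_Suc_eq a'_def t_def)
    finally show ?thesis ..
  qed
  then show ?case by blast
qed simp

lemma scalar_prod_mult_mat_vec:
  assumes "A \<in> carrier_mat n n" "v \<in> carrier_vec n"
  shows "scalar_prod v (A *\<^sub>v v)
    = (\<Sum>j<n. \<Sum>k<n. vec_index v j * A $$ (j, k) * vec_index v k)"
  using assms
  by (auto simp: scalar_prod_def mult_mat_vec_def sum_distrib_left mult.assoc lessThan_atLeast0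
      intro!: sum.cong)

lemma pos_def_mat_cholesky:
  assumes "pos_def_mat n A"
  obtains C where "C \<in> carrier_mat n n" "A = C * transpose_mat C"
proof -
  have A: "A \<in> carrier_mat n n" and sym: "transpose_mat A = A"
    and pos: "\<And>v. v \<in> carrier_vec n \<Longrightarrow> v \<noteq> 0\<^sub>v n \<Longrightarrow> scalar_prod v (A *\<^sub>v v) > 0"
    using assms by (auto simp: pos_def_mat_def)
  have "\<exists>c. \<forall>j<n. \<forall>k<n. A $$ (j, k) = (\<Sum>l<n. c j l * c k l)"
  proof (rule cholesky)
    show "A $$ (j, k) = A $$ (k, j)" if "j < n" "k < n" for j k
      using A that index_transpose_mat(1)[of j A k] by (simp add: sym)
    fix v :: "nat \<Rightarrow> real" assume "\<exists>j<n. v j \<noteq> 0"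
    then have "vec n v \<noteq> 0\<^sub>v n" by (auto simp: vec_eq_iff)
    from pos[OF _ this] show "(\<Sum>j<n. \<Sum>k<n. v j * A $$ (j, k) * v k) > 0"
      using A by (simp add: scalar_prod_mult_mat_vec)
  qed
  then obtain c where c: "\<And>j k. j < n \<Longrightarrow> k < n \<Longrightarrow> A $$ (j, k) = (\<Sum>l<n. c j l * c k l)"
    by blast
  have "A = Matrix.mat n n (\<lambda>(j, l). c j l) * transpose_mat (Matrix.mat n n (\<lambda>(j, l). c j l))"
    using A by (intro eq_matI) (auto simp: c scalar_prod_def lessThan_atLeast0)
  then show thesis by (intro that) auto
qed

text \<open>A nonzero determinant makes the matrix a unit, so \<open>mat_inverse\<close> returns
  \<open>Some\<close> and the \<open>the\<close> in \<open>inv_mat\<close> is harmless.\<close>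

lemma mat_inverse_mult:
  fixes A :: "real mat"
  assumes "A \<in> carrier_mat n n" "Determinant.det A \<noteq> 0"
  shows "inv_mat A \<in> carrier_mat n n" "A * inv_mat A = 1\<^sub>m n" "inv_mat A * A = 1\<^sub>m n"
proof -
  obtain B where "mat_inverse A = Some B"
    using mat_inverse(1)[OF assms(1)] det_non_zero_imp_unit[OF assms] by fastforce
  with mat_inverse(2)[OF assms(1) this]
  show "inv_mat A \<in> carrier_mat n n" "A * inv_mat A = 1\<^sub>m n" "inv_mat A * A = 1\<^sub>m n" by auto
qed

lemma inv_mat_eqI:
  fixes A :: "real mat"
  assumes "A \<in> carrier_mat n n" "B \<in> carrier_mat n n" "B * A = 1\<^sub>m n"
  shows "inv_mat A = B"
proof -
  have "Determinant.det B * Determinant.det A = 1"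
    using det_mult[OF assms(2,1)] assms(3) by simp
  then have "Determinant.det A \<noteq> 0" by auto
  note inv = mat_inverse_mult[OF assms(1) this]
  have "inv_mat A = (B * A) * inv_mat A" using inv(1) assms(3) by simp
  also have "\<dots> = B * (A * inv_mat A)" using assms inv(1) by (intro assoc_mult_mat)
  also have "\<dots> = B" using inv(2) assms(2) by simp
  finally show ?thesis .
qed

text \<open>By the factorization the determinant is a square, and it cannot vanish because a kernel
  vector would contradict definiteness.\<close>

lemma pos_def_mat_det_pos:
  assumes A: "pos_def_mat n A"
  shows "Determinant.det A > 0"
proof -
  from A obtain C where C: "C \<in> carrier_mat n n" "A = C * transpose_mat C"
    by (rule pos_def_mat_cholesky)
  have "Determinant.det A = (Determinant.det C)\<^sup>2"
    unfolding C(2) using C(1) by (simp add: det_mult[of _ n] det_transpose power2_eq_square)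
  moreover have "Determinant.det A \<noteq> 0"
  proof
    assume "Determinant.det A = 0"
    then obtain v where v: "v \<in> carrier_vec n" "v \<noteq> 0\<^sub>v n" "A *\<^sub>v v = 0\<^sub>v n"
      using A by (auto simp: pos_def_mat_def det_0_iff_vec_prod_zero_field)
    have "scalar_prod v (A *\<^sub>v v) > 0" using A v(1,2) by (simp add: pos_def_mat_def)
    then show False using v(1,3) by simp
  qed
  ultimately show ?thesis by simp
qed

text \<open>\<open>K\<close> is the inverse of the Cholesky factor: the change of coordinates in
  which \<open>A\<close> becomes the identity.\<close>

lemma pos_def_mat_whitening:
  assumes "pos_def_mat n A"
  obtains K where "K \<in> carrier_mat n n" "Determinant.det K \<noteq> 0"
    "K * A * transpose_mat K = 1\<^sub>m n" "inv_mat A = transpose_mat K * K"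
proof -
  from assms obtain C where C: "C \<in> carrier_mat n n" and AC: "A = C * transpose_mat C"
    by (rule pos_def_mat_cholesky)
  have "Determinant.det A = (Determinant.det C)\<^sup>2"
    unfolding AC using C by (simp add: det_mult[of _ n] det_transpose power2_eq_square)
  with pos_def_mat_det_pos[OF assms] have dC: "Determinant.det C \<noteq> 0" by auto
  define K where "K = inv_mat C"
  note K = mat_inverse_mult[OF C dC, folded K_def]
  have Ct: "transpose_mat C \<in> carrier_mat n n" and Kt: "transpose_mat K \<in> carrier_mat n n"
    using C K by auto
  have KCt: "transpose_mat C * transpose_mat K = 1\<^sub>m n"
    using transpose_mult[OF K(1) C] K(3) by simp
  have CKt: "transpose_mat K * transpose_mat C = 1\<^sub>m n"
    using transpose_mult[OF C K(1)] K(2) by simp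
  have "K * A * transpose_mat K = (K * C) * (transpose_mat C * transpose_mat K)"
    unfolding AC using C K(1) Ct Kt by (simp add: assoc_mult_mat[of _ n n _ n _ n])
  then have 1: "K * A * transpose_mat K = 1\<^sub>m n" using K(3) KCt by simp
  have "transpose_mat K * K * A = transpose_mat K * ((K * C) * transpose_mat C)"
    unfolding AC using C K(1) Ct Kt by (simp add: assoc_mult_mat[of _ n n _ n _ n])
  also have "\<dots> = 1\<^sub>m n" using K(3) CKt Ct by simp
  finally have "inv_mat A = transpose_mat K * K"
    using C Ct K(1) Kt unfolding AC by (intro inv_mat_eqI[of _ n]) auto
  moreover have "Determinant.det K \<noteq> 0"
    using det_mult[OF K(1) C] K(3) by auto
  ultimately show thesis using K(1) 1 by (intro that)
qed

section \<open>The Frobenius inner product and congruence\<close>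

lemma frobenius_self_nonneg: "frobenius A A \<ge> 0"
  unfolding frobenius_def by (intro sum_nonneg) simp

lemma frobenius_self_eq_0:
  assumes "A \<in> carrier_mat n n" "frobenius A A = 0"
  shows "A = 0\<^sub>m n n"
  using assms
  by (intro eq_matI) (auto simp: frobenius_def sum_nonneg_eq_0_iff sum_nonneg)

text \<open>Cyclicity of the trace: congruence by \<open>K\<close> and congruence by its transpose
  are adjoint. Both sides expand to the same fourfold sum.\<close>

lemma frobenius_congruence:
  assumes A: "A \<in> carrier_mat n n" and X: "X \<in> carrier_mat n n" and K: "K \<in> carrier_mat n n"
  shows "frobenius A (transpose_mat K * X * K) = frobenius (K * A * transpose_mat K) X"
proof -
  have entry: "(P * Q * R) $$ (j, k) = (\<Sum>a<n. \<Sum>b<n. P $$ (j, a) * Q $$ (a, b) * R $$ (b, k))"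
    if "P \<in> carrier_mat n n" "Q \<in> carrier_mat n n" "R \<in> carrier_mat n n" "j < n" "k < n"
    for P Q R :: "real mat" and j k
  proof -
    have "(P * Q * R) $$ (j, k) = (\<Sum>b<n. \<Sum>a<n. P $$ (j, a) * Q $$ (a, b) * R $$ (b, k))"
      using that by (simp add: scalar_prod_def lessThan_atLeast0 sum_distrib_right del: assoc_mult_mat)
    then show ?thesis by (subst sum.swap)
  qed
  have Kt: "transpose_mat K \<in> carrier_mat n n" using K by simp
  have "frobenius A (transpose_mat K * X * K)
      = (\<Sum>(j, k)\<in>{..<n} \<times> {..<n}. \<Sum>(a, b)\<in>{..<n} \<times> {..<n}.
          K $$ (a, j) * A $$ (j, k) * K $$ (b, k) * X $$ (a, b))"
    unfolding frobenius_def using A K X Kt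
    by (simp add: entry[OF Kt X K] sum.cartesian_product[symmetric] sum_distrib_left mult_ac
        del: index_mult_mat(1) assoc_mult_mat)
  also have "\<dots> = (\<Sum>(a, b)\<in>{..<n} \<times> {..<n}. \<Sum>(j, k)\<in>{..<n} \<times> {..<n}.
          K $$ (a, j) * A $$ (j, k) * K $$ (b, k) * X $$ (a, b))"
    unfolding case_prod_unfold by (rule sum.swap)
  also have "\<dots> = frobenius (K * A * transpose_mat K) X"
    unfolding frobenius_def using A K X Kt
    by (simp add: entry[OF K A Kt] sum.cartesian_product[symmetric] sum_distrib_right
        del: index_mult_mat(1) assoc_mult_mat)
  finally show ?thesis .
qed

text \<open>Cauchy-Schwarz for \<open>A\<close> and the rank-one matrix with entries
  \<open>v j * v k\<close>, whose Frobenius norm is \<open>scalar_prod v v\<close>.\<close>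

lemma abs_scalar_prod_mult_mat_vec_le:
  assumes A: "A \<in> carrier_mat n n" and v: "v \<in> carrier_vec n"
  shows "\<bar>scalar_prod v (A *\<^sub>v v)\<bar> \<le> sqrt (frobenius A A) * scalar_prod v v"
proof -
  let ?I = "{..<n} \<times> {..<n}"
  have "(scalar_prod v (A *\<^sub>v v))\<^sup>2
      = (\<Sum>(j, k)\<in>?I. A $$ (j, k) * (vec_index v j * vec_index v k))\<^sup>2"
    by (simp add: scalar_prod_mult_mat_vec[OF A v] sum.cartesian_product[symmetric] mult_ac)
  also have "\<dots> \<le> (\<Sum>(j, k)\<in>?I. (A $$ (j, k))\<^sup>2) * (\<Sum>(j, k)\<in>?I. (vec_index v j * vec_index v k)\<^sup>2)"
    unfolding case_prod_unfold by (rule Cauchy_Schwarz_ineq_sum)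
  also have "(\<Sum>(j, k)\<in>?I. (A $$ (j, k))\<^sup>2) = frobenius A A"
    using A
    by (simp add: frobenius_def sum.cartesian_product power2_eq_square case_prod_unfold)
  also have "(\<Sum>(j, k)\<in>?I. (vec_index v j * vec_index v k)\<^sup>2) = (scalar_prod v v)\<^sup>2"
    using v
    by (simp add: scalar_prod_def sum.cartesian_product[symmetric] power2_eq_square sum_product
        mult_ac lessThan_atLeast0)
  finally have le: "(scalar_prod v (A *\<^sub>v v))\<^sup>2 \<le> frobenius A A * (scalar_prod v v)\<^sup>2" .
  have "scalar_prod v v \<ge> 0"
    by (simp add: scalar_prod_def sum_nonneg)
  with real_sqrt_le_mono[OF le] show ?thesis by (simp add: real_sqrt_mult)
qed

text \<open>Each summand of the quadratic form of the Hessian has the shape on the left of the last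
  equation; in whitened coordinates it becomes a squared Frobenius norm.\<close>

lemma frobenius_inv_congruence:
  assumes A: "pos_def_mat n A" and B: "B \<in> carrier_mat n n"
  obtains K where "K \<in> carrier_mat n n" "Determinant.det K \<noteq> 0"
    "K * A * transpose_mat K = 1\<^sub>m n" "inv_mat A = transpose_mat K * K"
    "inv_mat A * B * inv_mat A = transpose_mat K * (K * B * transpose_mat K) * K"
    "frobenius B (inv_mat A * B * inv_mat A)
      = frobenius (K * B * transpose_mat K) (K * B * transpose_mat K)"
proof -
  from A obtain K where K: "K \<in> carrier_mat n n" "Determinant.det K \<noteq> 0"
      "K * A * transpose_mat K = 1\<^sub>m n" "inv_mat A = transpose_mat K * K"
    by (rule pos_def_mat_whitening)
  have Kt: "transpose_mat K \<in> carrier_mat n n" using K by simp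
  have eq: "inv_mat A * B * inv_mat A = transpose_mat K * (K * B * transpose_mat K) * K"
    unfolding K(4) using K(1) Kt B by (simp add: assoc_mult_mat[of _ n n _ n _ n])
  show thesis
    by (rule that[OF K eq]) (unfold eq, rule frobenius_congruence, use K(1) Kt B in auto)
qed

lemma frobenius_inv_congruence_nonneg:
  assumes "pos_def_mat n A" "B \<in> carrier_mat n n"
  shows "frobenius B (inv_mat A * B * inv_mat A) \<ge> 0"
  using frobenius_inv_congruence[OF assms] frobenius_self_nonneg by metis

text \<open>The squared norm of \<open>K * B * transpose_mat K\<close> vanishes, and the congruence
  is undone with the inverse \<open>J\<close> of \<open>K\<close>.\<close>

lemma frobenius_inv_congruence_eq_0:
  assumes A: "pos_def_mat n A" and B: "B \<in> carrier_mat n n"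
    and 0: "frobenius B (inv_mat A * B * inv_mat A) = 0"
  shows "B = 0\<^sub>m n n"
proof -
  from A B obtain K where K: "K \<in> carrier_mat n n" "Determinant.det K \<noteq> 0"
    and fr: "frobenius B (inv_mat A * B * inv_mat A)
      = frobenius (K * B * transpose_mat K) (K * B * transpose_mat K)"
    by (rule frobenius_inv_congruence)
  have Kt: "transpose_mat K \<in> carrier_mat n n" using K by simp
  have zero: "K * B * transpose_mat K = 0\<^sub>m n n"
    using frobenius_self_eq_0[of "K * B * transpose_mat K" n] fr 0 K(1) B Kt by auto
  define J where "J = inv_mat K"
  note J = mat_inverse_mult[OF K, folded J_def]
  have Jt: "transpose_mat J \<in> carrier_mat n n" using J by simp
  have KtJt: "transpose_mat K * transpose_mat J = 1\<^sub>m n"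
    using transpose_mult[OF J(1) K(1)] J(3) by simp
  have "J * (K * B * transpose_mat K) * transpose_mat J = (J * K) * B * (transpose_mat K * transpose_mat J)"
    using J(1) Jt K(1) Kt B by (simp add: assoc_mult_mat[of _ n n _ n _ n])
  also have "\<dots> = B" using J(3) KtJt B by simp
  finally show ?thesis using zero J(1) Jt by simp
qed

text \<open>To be used with \<open>A\<close> and \<open>W\<close> the images of \<open>x\<close> and
  \<open>w\<close>. Whitening turns \<open>W\<close> into \<delta> times the identity plus
  \<open>E\<close>, where \<open>E\<close> has Frobenius norm below \<delta>; so the form at
  \<open>z = K *\<^sub>v v\<close> exceeds zero, and \<open>z\<close> is nonzero because
  \<open>K\<close> is invertible.\<close>

lemma pos_def_mat_inv_congruence:
  assumes A: "pos_def_mat n A" and W: "W \<in> carrier_mat n n" "transpose_mat W = W"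
    and \<delta>: "\<delta> > 0"
    and B: "B = W - \<delta> \<cdot>\<^sub>m A"
    and small: "frobenius B (inv_mat A * B * inv_mat A) < \<delta>\<^sup>2"
  shows "pos_def_mat n (inv_mat A * W * inv_mat A)"
proof -
  have A_car: "A \<in> carrier_mat n n" using A by (simp add: pos_def_mat_def)
  then have B_car: "B \<in> carrier_mat n n"
    unfolding B by (intro minus_carrier_mat smult_carrier_mat)
  from A B_car obtain K where K: "K \<in> carrier_mat n n" "Determinant.det K \<noteq> 0"
      "K * A * transpose_mat K = 1\<^sub>m n" "inv_mat A = transpose_mat K * K"
    and fr: "frobenius B (inv_mat A * B * inv_mat A)
      = frobenius (K * B * transpose_mat K) (K * B * transpose_mat K)"
    by (rule frobenius_inv_congruence)
  have Kt: "transpose_mat K \<in> carrier_mat n n" using K by simp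
  define E where "E = K * B * transpose_mat K"
  have E: "E \<in> carrier_mat n n" using K(1) Kt B_car by (simp add: E_def)
  have W_eq: "W = B + \<delta> \<cdot>\<^sub>m A" using W(1) A_car by (intro eq_matI) (auto simp: B)
  have KWK: "K * W * transpose_mat K = E + \<delta> \<cdot>\<^sub>m 1\<^sub>m n"
    unfolding W_eq E_def K(3)[symmetric] using A_car B_car K(1) Kt
    by (simp add: mult_add_distrib_mat[of _ n n _ n] add_mult_distrib_mat[of _ n n _ _ n]
        mult_smult_distrib[of _ n n _ n] mult_smult_assoc_mat[of _ n n _ n])
  have S_eq: "inv_mat A * W * inv_mat A = transpose_mat K * (E + \<delta> \<cdot>\<^sub>m 1\<^sub>m n) * K"
    unfolding K(4) KWK[symmetric] using K(1) Kt W(1) by (simp add: assoc_mult_mat[of _ n n _ n _ n])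
  have "transpose_mat (inv_mat A * W * inv_mat A) = inv_mat A * W * inv_mat A"
    unfolding K(4) using K(1) Kt W
    by (simp add: transpose_mult[of _ n n _ n] assoc_mult_mat[of _ n n _ n _ n])
  moreover have "scalar_prod v (inv_mat A * W * inv_mat A *\<^sub>v v) > 0"
    if v: "v \<in> carrier_vec n" "v \<noteq> 0\<^sub>v n" for v
  proof -
    define z where "z = K *\<^sub>v v"
    have z: "z \<in> carrier_vec n" using K(1) v(1) by (simp add: z_def)
    have "z \<noteq> 0\<^sub>v n"
      using K(1,2) v det_0_iff_vec_prod_zero_field[OF K(1)] by (auto simp: z_def)
    then have zz: "scalar_prod z z > 0"
      using z conjugate_square_greater_0_vec[of z n] by (simp add: conjugate_vec_def)
    have "inv_mat A * W * inv_mat A *\<^sub>v v = transpose_mat K *\<^sub>v ((E + \<delta> \<cdot>\<^sub>m 1\<^sub>m n) *\<^sub>v z)"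
      unfolding S_eq z_def using K(1) Kt E v(1) by (simp add: assoc_mult_mat_vec[of _ n n _ n])
    also have "scalar_prod v \<dots> = scalar_prod z ((E + \<delta> \<cdot>\<^sub>m 1\<^sub>m n) *\<^sub>v z)"
    proof -
      have y: "(E + \<delta> \<cdot>\<^sub>m 1\<^sub>m n) *\<^sub>v z \<in> carrier_vec n"
        by (rule mult_mat_vec_carrier[OF _ z]) simp
      show ?thesis
        using transpose_vec_mult_scalar[OF K(1) v(1) y] y z v(1) Kt
          comm_scalar_prod[OF v(1) mult_mat_vec_carrier[OF Kt y]] comm_scalar_prod[OF z y]
        by (simp add: z_def)
    qed
    also have "(E + \<delta> \<cdot>\<^sub>m 1\<^sub>m n) *\<^sub>v z = E *\<^sub>v z + \<delta> \<cdot>\<^sub>v z"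
      using E z by (intro eq_vecI) (auto simp: add_scalar_prod_distrib[of _ n])
    also have "scalar_prod z (E *\<^sub>v z + \<delta> \<cdot>\<^sub>v z) = scalar_prod z (E *\<^sub>v z) + \<delta> * scalar_prod z z"
      using E z by (simp add: scalar_prod_add_distrib[of _ n])
    finally have eq: "scalar_prod v (inv_mat A * W * inv_mat A *\<^sub>v v)
        = scalar_prod z (E *\<^sub>v z) + \<delta> * scalar_prod z z" .
    have "sqrt (frobenius E E) < sqrt (\<delta>\<^sup>2)"
      using small unfolding fr E_def[symmetric] by (rule real_sqrt_less_mono)
    then have "sqrt (frobenius E E) * scalar_prod z z < \<delta> * scalar_prod z z"
      using \<delta> zz by simp
    with abs_scalar_prod_mult_mat_vec_le[OF E z] show ?thesis unfolding eq by linarith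
  qed
  moreover have "inv_mat A * W * inv_mat A \<in> carrier_mat n n"
    unfolding K(4) using K(1) Kt W(1) by (intro carrier_matI) auto
  ultimately show ?thesis by (simp add: pos_def_mat_def)
qed

lemma frobenius_commute:
  assumes "A \<in> carrier_mat n n" "B \<in> carrier_mat n n"
  shows "frobenius A B = frobenius B A"
  using assms by (simp add: frobenius_def mult.commute)

lemma inv_mat_pos_def:
  assumes A: "pos_def_mat n A"
  shows "inv_mat A \<in> carrier_mat n n" "transpose_mat (inv_mat A) = inv_mat A"
    "inv_mat A * A = 1\<^sub>m n"
proof -
  from A obtain K where K: "K \<in> carrier_mat n n" "inv_mat A = transpose_mat K * K"
    by (rule pos_def_mat_whitening)
  then show "inv_mat A \<in> carrier_mat n n" by simp
  show "transpose_mat (inv_mat A) = inv_mat A"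
    unfolding K(2) using K(1) by (simp add: transpose_mult[of _ n n _ n])
  show "inv_mat A * A = 1\<^sub>m n"
    using A pos_def_mat_det_pos[OF A] by (intro mat_inverse_mult) (auto simp: pos_def_mat_def)
qed

text \<open>This is the symmetry of the Hessian, summand by summand: the inverse is its own
  transpose, so congruence by it is self-adjoint.\<close>

lemma frobenius_inv_congruence_commute:
  assumes A: "pos_def_mat n A" and B: "B \<in> carrier_mat n n" "C \<in> carrier_mat n n"
  shows "frobenius B (inv_mat A * C * inv_mat A) = frobenius C (inv_mat A * B * inv_mat A)"
proof -
  note N = inv_mat_pos_def[OF A]
  have "frobenius B (inv_mat A * C * inv_mat A) = frobenius (inv_mat A * B * inv_mat A) C"
    using frobenius_congruence[OF B N(1)] by (simp only: N(2))
  also have "\<dots> = frobenius C (inv_mat A * B * inv_mat A)"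
    using N(1) B by (intro frobenius_commute[of _ n] mult_carrier_mat) auto
  finally show ?thesis .
qed

section \<open>Gradients as unique values, and inverses of matrices over
  \<open>real ^ 'u\<close>\<close>

lemma gradient_eqI:
  assumes "GDERIV f x :> D"
  shows "gradient f x = D"
  unfolding gradient_def
proof (rule the_equality)
  show "GDERIV f x :> D" by (rule assms)
  fix D' assume "GDERIV f x :> D'"
  \<comment> \<open>Uniqueness of the derivative, and then of the vector representing it, settles
    the definite description in \<open>gradient\<close>.\<close>
  then have "(\<lambda>h. inner h D') = (\<lambda>h. inner h D)"
    using assms unfolding gderiv_def by (rule has_derivative_unique)
  then show "D' = D" by (metis vector_eq_rdot inner_commute)
qed

lemma matrix_inv_invertible:
  fixes A :: "real ^ 'u ^ 'u::finite"
  assumes "invertible A"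
  shows "A *v (matrix_inv A *v y) = y" "matrix_inv A *v (A *v y) = y"
proof -
  have "A ** matrix_inv A = Finite_Cartesian_Product.mat 1 \<and> matrix_inv A ** A = Finite_Cartesian_Product.mat 1"
    unfolding matrix_inv_def by (rule someI_ex) (use assms in \<open>simp add: invertible_def\<close>)
  then show "A *v (matrix_inv A *v y) = y" "matrix_inv A *v (A *v y) = y"
    by (simp_all add: matrix_vector_mul_assoc)
qed

lemma pos_semidef_matrix_inv:
  fixes A :: "real ^ 'u ^ 'u::finite"
  assumes A: "pos_semidef A" "invertible A"
  shows "pos_semidef (matrix_inv A)"
  unfolding pos_semidef_def
proof (intro conjI allI inner_symmetric_imp_transpose_eq)
  have sym: "inner (A *v x) y = inner x (A *v y)" for x y
    using A(1) by (simp add: pos_semidef_def transpose_eq_imp_inner_symmetric)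
  show "inner (matrix_inv A *v x) y = inner x (matrix_inv A *v y)" for x y
    using sym[of "matrix_inv A *v x" "matrix_inv A *v y"] by (simp add: matrix_inv_invertible[OF A(2)])
  show "0 \<le> inner v (matrix_inv A *v v)" for v
  proof -
    have "0 \<le> inner (matrix_inv A *v v) (A *v (matrix_inv A *v v))"
      using A(1) by (simp add: pos_semidef_def)
    then show ?thesis by (simp add: matrix_inv_invertible[OF A(2)] inner_commute)
  qed
qed

subsection \<open>Derivatives of determinant and inverse\<close>

text \<open>The Leibniz formula is differentiated term by term with the product rule.\<close>

lemma det_has_derivative:
  fixes A :: "'a::real_normed_vector \<Rightarrow> real mat"
  assumes car: "\<And>z. A z \<in> carrier_mat n n"
    and der: "\<And>j k. j < n \<Longrightarrow> k < n \<Longrightarrow> ((\<lambda>z. A z $$ (j, k)) has_derivative A' j k) (at x)"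
  shows "((\<lambda>z. Determinant.det (A z)) has_derivative
    (\<lambda>h. \<Sum>p | p permutes {0..<n}. signof p *
        (\<Sum>i\<in>{0..<n}. A' i (p i) h * (\<Prod>j\<in>{0..<n} - {i}. A x $$ (j, p j))))) (at x)"
proof -
  have det: "Determinant.det (A z)
      = (\<Sum>p | p permutes {0..<n}. signof p * (\<Prod>i\<in>{0..<n}. A z $$ (i, p i)))" for z
    using car[of z] by (simp add: Determinant.det_def)
  show ?thesis
    unfolding det
    by (intro has_derivative_sum has_derivative_mult_right has_derivative_prod der)
      (auto dest: permutes_in_image)
qed

text \<open>A permutation other than the identity moves at least two indices, so after one factor is
  differentiated another off-diagonal entry of the identity matrix remains. Only the trace of the
  derivative survives.\<close>

lemma det_has_derivative_at_one:
  fixes A :: "'a::real_normed_vector \<Rightarrow> real mat"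
  assumes car: "\<And>z. A z \<in> carrier_mat n n" and one: "A x = 1\<^sub>m n"
    and der: "\<And>j k. j < n \<Longrightarrow> k < n \<Longrightarrow> ((\<lambda>z. A z $$ (j, k)) has_derivative A' j k) (at x)"
  shows "((\<lambda>z. Determinant.det (A z)) has_derivative (\<lambda>h. \<Sum>i<n. A' i i h)) (at x)"
proof -
  have "(\<Sum>p | p permutes {0..<n}. signof p *
        (\<Sum>i\<in>{0..<n}. A' i (p i) h * (\<Prod>j\<in>{0..<n} - {i}. A x $$ (j, p j))))
      = (\<Sum>i<n. A' i i h)" (is "?lhs = _") for h
  proof -
    have zero: "(\<Prod>j\<in>{0..<n} - {i}. A x $$ (j, p j)) = 0"
      if p: "p permutes {0..<n}" "p \<noteq> id" and i: "i < n" for p i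
    proof -
      have "\<exists>j<n. j \<noteq> i \<and> p j \<noteq> j"
      proof (rule ccontr)
        assume "\<not> ?thesis"
        \<comment> \<open>If \<open>i\<close> were the only index moved, its image would already be
          taken, against injectivity.\<close>
        then have fix_others: "p j = j" if "j \<noteq> i" for j
          using that p(1) by (metis atLeastLessThan_iff le0 permutes_not_in)
        then have "p i = i" using permutes_inj[OF p(1)] by (metis injD)
        then have "p = id" using fix_others by (metis eq_id_iff)
        with p(2) show False ..
      qed
      then obtain j where j: "j < n" "j \<noteq> i" "p j \<noteq> j" by blast
      have "p j < n" using p(1) j(1) permutes_in_image by fastforce
      with j have "j \<in> {0..<n} - {i}" "A x $$ (j, p j) = 0" by (auto simp: one)
      then show ?thesis by (intro prod_zero) auto
    qed
    have "?lhs = (\<Sum>p\<in>{id}. signof p *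
        (\<Sum>i\<in>{0..<n}. A' i (p i) h * (\<Prod>j\<in>{0..<n} - {i}. A x $$ (j, p j))))"
      by (rule sum.mono_neutral_right) (auto simp: finite_permutations permutes_id zero)
    also have "\<dots> = (\<Sum>i<n. A' i i h)"
      by (simp add: one lessThan_atLeast0)
    finally show ?thesis .
  qed
  with det_has_derivative[OF car der] show ?thesis by simp
qed

text \<open>Isolates what the calculus uses of the operators \<open>Lam\<close>. Matrices are
  differentiated entry by entry, so linearity is required of each entry separately.\<close>

locale symmetric_pencil =
  fixes n :: nat and \<Lambda> :: "'a::real_normed_vector \<Rightarrow> real mat"
  assumes carrier [simp]: "\<Lambda> x \<in> carrier_mat n n"
    and bounded_linear_entry: "j < n \<Longrightarrow> k < n \<Longrightarrow> bounded_linear (\<lambda>x. \<Lambda> x $$ (j, k))"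
    and symmetric: "transpose_mat (\<Lambda> x) = \<Lambda> x"
begin

lemma dim [simp]: "dim_row (\<Lambda> x) = n" "dim_col (\<Lambda> x) = n"
  using carrier_matD[OF carrier[of x]] by blast+

lemma entry_commute: "j < n \<Longrightarrow> k < n \<Longrightarrow> \<Lambda> x $$ (j, k) = \<Lambda> x $$ (k, j)"
  using index_transpose_mat(1)[of j "\<Lambda> x" k] by (simp add: symmetric)

lemma entry_has_derivative:
  "j < n \<Longrightarrow> k < n \<Longrightarrow> ((\<lambda>x. \<Lambda> x $$ (j, k)) has_derivative (\<lambda>h. \<Lambda> h $$ (j, k))) (at x)"
  using bounded_linear_imp_has_derivative[OF bounded_linear_entry] .

lemma scaleR: "\<Lambda> (c *\<^sub>R x) = c \<cdot>\<^sub>m \<Lambda> x"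
  using linear_scale[OF bounded_linear.linear[OF bounded_linear_entry]]
  by (intro eq_matI) auto

lemma diff: "\<Lambda> (x - y) = \<Lambda> x - \<Lambda> y"
  using linear_diff[OF bounded_linear.linear[OF bounded_linear_entry]]
  by (intro eq_matI) auto

text \<open>Jacobi's formula, reduced to the derivative at the identity by multiplying with the
  fixed inverse \<open>N\<close> of \<open>\<Lambda> x\<close>. Symmetry of
  \<open>\<Lambda> h\<close> turns the trace of \<open>N * \<Lambda> h\<close> into a Frobenius
  product.\<close>

lemma det_has_derivative_inv:
  assumes x: "Determinant.det (\<Lambda> x) \<noteq> 0"
  shows "((\<lambda>z. Determinant.det (\<Lambda> z)) has_derivative
    (\<lambda>h. Determinant.det (\<Lambda> x) * frobenius (\<Lambda> h) (inv_mat (\<Lambda> x)))) (at x)"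
proof -
  define N where "N = inv_mat (\<Lambda> x)"
  note N = mat_inverse_mult[OF carrier x, folded N_def]
  have entry: "(N * \<Lambda> z) $$ (j, k) = (\<Sum>l<n. N $$ (j, l) * \<Lambda> z $$ (l, k))"
    if "j < n" "k < n" for z j k
    using that N(1) by (auto simp: scalar_prod_def lessThan_atLeast0)
  have "((\<lambda>z. Determinant.det (N * \<Lambda> z)) has_derivative
      (\<lambda>h. \<Sum>i<n. \<Sum>l<n. N $$ (i, l) * \<Lambda> h $$ (l, i))) (at x)"
  proof (rule det_has_derivative_at_one[where A = "\<lambda>z. N * \<Lambda> z" and n = n
        and A' = "\<lambda>j k h. \<Sum>l<n. N $$ (j, l) * \<Lambda> h $$ (l, k)"])
    show "N * \<Lambda> z \<in> carrier_mat n n" for z using mult_carrier_mat[OF N(1) carrier] .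
    show "N * \<Lambda> x = 1\<^sub>m n" by (rule N(3))
    fix j k assume "j < n" "k < n"
    then show "((\<lambda>z. (N * \<Lambda> z) $$ (j, k)) has_derivative
        (\<lambda>h. \<Sum>l<n. N $$ (j, l) * \<Lambda> h $$ (l, k))) (at x)"
      unfolding entry[OF \<open>j < n\<close> \<open>k < n\<close>]
      by (intro has_derivative_sum has_derivative_mult_right entry_has_derivative) auto
  qed
  then have "((\<lambda>z. Determinant.det (\<Lambda> x) * Determinant.det (N * \<Lambda> z)) has_derivative
      (\<lambda>h. Determinant.det (\<Lambda> x) * (\<Sum>i<n. \<Sum>l<n. N $$ (i, l) * \<Lambda> h $$ (l, i)))) (at x)"
    by (rule has_derivative_mult_right)
  moreover have "Determinant.det (\<Lambda> x) * Determinant.det (N * \<Lambda> z) = Determinant.det (\<Lambda> z)" for z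
  proof -
    have "\<Lambda> x * (N * \<Lambda> z) = \<Lambda> z"
      using N(1,2) assoc_mult_mat[OF carrier N(1) carrier, of x z, symmetric] by simp
    then show ?thesis using det_mult[OF carrier mult_carrier_mat[OF N(1) carrier]] by metis
  qed
  moreover have "(\<Sum>i<n. \<Sum>l<n. N $$ (i, l) * \<Lambda> h $$ (l, i)) = frobenius (\<Lambda> h) N" for h
    by (auto simp: frobenius_def entry_commute mult.commute intro!: sum.cong)
  ultimately show ?thesis by (simp add: N_def)
qed

lemma continuous_det: "continuous_on S (\<lambda>z. Determinant.det (\<Lambda> z))"
  using has_derivative_continuous[OF det_has_derivative[OF carrier entry_has_derivative]]
  by (intro continuous_at_imp_continuous_on) auto

lemma open_det_pos: "open {z. Determinant.det (\<Lambda> z) > 0}"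
  using open_Collect_less[OF continuous_on_const continuous_det] by simp

text \<open>By the adjugate formula an entry of the inverse is a signed minor divided by the
  determinant. Only differentiability is extracted here; the derivative itself is found afterwards
  from the product rule.\<close>

lemma inv_entry_differentiable:
  assumes x: "Determinant.det (\<Lambda> x) > 0" and jk: "j < n" "k < n"
  shows "(\<lambda>z. inv_mat (\<Lambda> z) $$ (j, k)) differentiable (at x)"
proof -
  let ?U = "{z. Determinant.det (\<Lambda> z) > 0}"
  \<comment> \<open>The indices are swapped because the adjugate is the transposed cofactor
    matrix.\<close>
  have car: "mat_delete (\<Lambda> z) k j \<in> carrier_mat (n - 1) (n - 1)" for z
    using mat_delete_carrier[OF carrier] .
  have "((\<lambda>z. mat_delete (\<Lambda> z) k j $$ (r, c)) has_derivative
      (\<lambda>h. mat_delete (\<Lambda> h) k j $$ (r, c))) (at x)" if "r < n - 1" "c < n - 1" for r c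
    unfolding mat_delete_def using that by (auto intro!: entry_has_derivative)
  from det_has_derivative[OF car this]
  have minor: "(\<lambda>z. Determinant.det (mat_delete (\<Lambda> z) k j)) differentiable (at x)"
    unfolding differentiable_def by blast
  have det: "(\<lambda>z. Determinant.det (\<Lambda> z)) differentiable (at x)"
    using det_has_derivative[OF carrier entry_has_derivative] unfolding differentiable_def by blast
  have "(\<lambda>z. (-1) ^ (k + j) * Determinant.det (mat_delete (\<Lambda> z) k j) / Determinant.det (\<Lambda> z))
      differentiable (at x)"
    using x by (intro differentiable_divide differentiable_mult differentiable_const minor det) auto
  then obtain D where D: "((\<lambda>z. (-1) ^ (k + j) * Determinant.det (mat_delete (\<Lambda> z) k j)
      / Determinant.det (\<Lambda> z)) has_derivative D) (at x)"
    unfolding differentiable_def by blast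
  have "((\<lambda>z. inv_mat (\<Lambda> z) $$ (j, k)) has_derivative D) (at x)"
  proof (rule has_derivative_transform_within_open[OF D open_det_pos])
    show "x \<in> ?U" using x by simp
    fix z assume "z \<in> ?U"
    then have z: "Determinant.det (\<Lambda> z) \<noteq> 0" by simp
    have "inv_mat (\<Lambda> z) = (1 / Determinant.det (\<Lambda> z)) \<cdot>\<^sub>m adj_mat (\<Lambda> z)"
      using adj_mat[OF carrier, of z] z
      by (intro inv_mat_eqI[of _ n]) (auto simp: mult_smult_assoc_mat[of _ n n _ n])
    then show "(-1) ^ (k + j) * Determinant.det (mat_delete (\<Lambda> z) k j) / Determinant.det (\<Lambda> z)
        = inv_mat (\<Lambda> z) $$ (j, k)"
      using jk by (simp add: adj_mat_def cofactor_def)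
  qed
  then show ?thesis unfolding differentiable_def by blast
qed

text \<open>The product of inverse and matrix is constant wherever the determinant is positive.
  Differentiating it gives a linear equation for the derivative of the inverse, solved by
  multiplying with \<open>N\<close> from the right.\<close>

lemma inv_entry_has_derivative:
  assumes x: "Determinant.det (\<Lambda> x) > 0" and jk: "j < n" "k < n"
  shows "((\<lambda>z. inv_mat (\<Lambda> z) $$ (j, k)) has_derivative
    (\<lambda>h. - (inv_mat (\<Lambda> x) * \<Lambda> h * inv_mat (\<Lambda> x)) $$ (j, k))) (at x)"
proof -
  define N where "N = inv_mat (\<Lambda> x)"
  note N = mat_inverse_mult[OF carrier less_imp_neq[OF x, symmetric], folded N_def]
  have "\<exists>D. \<forall>j k. j < n \<longrightarrow> k < n \<longrightarrow> ((\<lambda>z. inv_mat (\<Lambda> z) $$ (j, k)) has_derivative D j k) (at x)"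
    using inv_entry_differentiable[OF x] unfolding differentiable_def by metis
  then obtain D where D: "\<And>j k. j < n \<Longrightarrow> k < n \<Longrightarrow>
      ((\<lambda>z. inv_mat (\<Lambda> z) $$ (j, k)) has_derivative D j k) (at x)"
    by blast
  have prod: "(\<Sum>l<n. N $$ (j, l) * \<Lambda> h $$ (l, k) + D j l h * \<Lambda> x $$ (l, k)) = 0"
    if jk: "j < n" "k < n" for j k h
  proof -
    let ?f = "\<lambda>z. \<Sum>l<n. inv_mat (\<Lambda> z) $$ (j, l) * \<Lambda> z $$ (l, k)"
    have "(?f has_derivative
        (\<lambda>h. \<Sum>l<n. N $$ (j, l) * \<Lambda> h $$ (l, k) + D j l h * \<Lambda> x $$ (l, k))) (at x)"
      unfolding N_def using jk
      by (intro has_derivative_sum has_derivative_mult D entry_has_derivative) auto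
    moreover have "(?f has_derivative (\<lambda>h. 0)) (at x)"
    proof (rule has_derivative_transform_within_open[OF has_derivative_const open_det_pos])
      show "x \<in> {z. Determinant.det (\<Lambda> z) > 0}" using x by simp
      fix z assume "z \<in> {z. Determinant.det (\<Lambda> z) > 0}"
      then have "Determinant.det (\<Lambda> z) \<noteq> 0" by simp
      note inv = mat_inverse_mult[OF carrier this]
      have "?f z = (inv_mat (\<Lambda> z) * \<Lambda> z) $$ (j, k)"
        using jk inv(1) by (auto simp: scalar_prod_def lessThan_atLeast0)
      then show "1\<^sub>m n $$ (j, k) = ?f z" by (simp only: inv(3))
    qed
    ultimately show ?thesis
      using has_derivative_unique by (metis (no_types, lifting))
  qed
  have "D j k h = - (N * \<Lambda> h * N) $$ (j, k)" for h
  proof -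
    \<comment> \<open>Collecting the entry derivatives in a matrix turns the scalar equations
      \<open>prod\<close> into \<open>X * \<Lambda> x = - (N * \<Lambda> h)\<close>.\<close>
    define X where "X = Matrix.mat n n (\<lambda>(j, k). D j k h)"
    have X: "X \<in> carrier_mat n n" by (simp add: X_def)
    have "X * \<Lambda> x = - (N * \<Lambda> h)"
    proof (rule eq_matI)
      fix j k assume "j < dim_row (- (N * \<Lambda> h))" "k < dim_col (- (N * \<Lambda> h))"
      then have jk: "j < n" "k < n" using N(1) by auto
      have "(X * \<Lambda> x) $$ (j, k) = (\<Sum>l<n. D j l h * \<Lambda> x $$ (l, k))"
        "(N * \<Lambda> h) $$ (j, k) = (\<Sum>l<n. N $$ (j, l) * \<Lambda> h $$ (l, k))"
        using jk N(1) by (auto simp: X_def scalar_prod_def lessThan_atLeast0)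
      with prod[OF jk, of h] show "(X * \<Lambda> x) $$ (j, k) = (- (N * \<Lambda> h)) $$ (j, k)"
        using jk N(1) by (simp add: sum.distrib)
    qed (use X N(1) in auto)
    then have "X * \<Lambda> x * N = - (N * \<Lambda> h * N)"
      using N(1) by (simp del: assoc_mult_mat)
    moreover have "X * \<Lambda> x * N = X"
      using assoc_mult_mat[OF X carrier N(1)] N(2) X by simp
    ultimately have "X $$ (j, k) = (- (N * \<Lambda> h * N)) $$ (j, k)" by metis
    also have "\<dots> = - (N * \<Lambda> h * N) $$ (j, k)"
      using jk N(1) by (intro index_uminus_mat(1)) auto
    finally show ?thesis using jk by (simp add: X_def)
  qed
  then have "D j k = (\<lambda>h. - (N * \<Lambda> h * N) $$ (j, k))" by (rule ext)
  with D[OF jk] show ?thesis unfolding N_def by metis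
qed

end

subsection \<open>Weighted sums of squares\<close>

lemma mon_degree_superset:
  assumes "finite K" "Poly_Mapping.keys a \<subseteq> K"
  shows "mon_degree a = (\<Sum>v\<in>K. Poly_Mapping.lookup a v)"
  unfolding mon_degree_def using assms
  by (intro sum.mono_neutral_left) (auto simp: in_keys_iff)

lemma mon_degree_add: "mon_degree (a + b) = mon_degree a + mon_degree b"
proof -
  let ?K = "Poly_Mapping.keys a \<union> Poly_Mapping.keys b"
  have "mon_degree (a + b) = (\<Sum>v\<in>?K. Poly_Mapping.lookup (a + b) v)"
    by (rule mon_degree_superset) (use Poly_Mapping.keys_add[of a b] in auto)
  also have "\<dots> = mon_degree a + mon_degree b"
    using mon_degree_superset[of ?K a] mon_degree_superset[of ?K b]
    by (simp add: lookup_add sum.distrib)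
  finally show ?thesis .
qed

lemma polys_deg_mult:
  assumes "f \<in> polys_deg n r" "h \<in> polys_deg n t"
  shows "f * h \<in> polys_deg n (r + t)"
proof -
  have "Poly_Mapping.keys c \<subseteq> {..<n} \<and> mon_degree c \<le> r + t"
    if c: "c \<in> Poly_Mapping.keys (f * h)" for c
  proof -
    from c keys_mult obtain a b where
      ab: "c = a + b" "a \<in> Poly_Mapping.keys f" "b \<in> Poly_Mapping.keys h" by blast
    then show ?thesis
      using assms Poly_Mapping.keys_add[of a b]
      by (fastforce simp: polys_deg_def polys_def mon_degree_add intro: add_mono)
  qed
  then show ?thesis by (auto simp: polys_deg_def polys_def)
qed

lemma zero_in_polys_deg: "0 \<in> polys_deg n r"
  by (simp add: polys_deg_def polys_def)

text \<open>With scaling written as multiplication by a constant polynomial, the ring laws move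
  scalars through products.\<close>

lemma scaleR_eq_single_mult:
  "c *\<^sub>R f = Poly_Mapping.single 0 c * (f :: ('a::monoid_add) \<Rightarrow>\<^sub>0 real)"
proof -
  have "finite {k. c * Poly_Mapping.lookup f k \<noteq> 0}"
    by (rule finite_subset[OF _ finite_lookup[of f]]) auto
  then have "c *\<^sub>R f = Poly_Mapping.map ((*) c) f"
    by (intro poly_mapping_eqI)
      (auto simp: scaleR_poly_mapping_def Poly_Mapping.map.rep_eq when_def)
  then show ?thesis by (simp add: mult_map_scale_conv_mult)
qed

text \<open>Taking zero for all other multipliers exhibits a single weighted term as an element of
  \<open>weighted_polys\<close> or \<open>weighted_sos\<close>.\<close>

lemma sum_mult_if_eq:
  fixes g :: "nat \<Rightarrow> mpoly"
  assumes "i < m"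
  shows "(\<Sum>j<m. g j * (if j = i then f else 0)) = g i * f"
proof -
  have "(\<Sum>j<m. g j * (if j = i then f else 0)) = (\<Sum>j<m. if j = i then g i * f else 0)"
    by (intro sum.cong) auto
  then show ?thesis using assms by simp
qed

locale sos_bases =
  fixes n m :: nat and g :: "nat \<Rightarrow> mpoly" and d L :: "nat \<Rightarrow> nat"
    and q :: "'u::finite \<Rightarrow> mpoly" and p :: "nat \<Rightarrow> nat \<Rightarrow> mpoly"
  assumes weight_nonzero: "i < m \<Longrightarrow> g i \<noteq> 0"
    and basis_q: "basis_family UNIV q (weighted_polys n m g d)"
    and basis_p: "i < m \<Longrightarrow> basis_family {..<L i} (p i) (polys_deg n (d i))"
begin

abbreviation "\<Lambda> i \<equiv> Lam q (g i) (L i) (p i)"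
abbreviation "\<C> \<equiv> sos_cone n m g d q"

lemma q_basis: "independent (range q)" "span (range q) = weighted_polys n m g d"
  using basis_q by (auto simp: basis_family_def)

text \<open>\<open>representation\<close> takes the default value 0 outside the span, so
  \<open>coeff_vec\<close> is linear only inside it; this supplies the membership for all terms that
  occur.\<close>

lemma weighted_product_in_span:
  assumes i: "i < m" and "f \<in> polys_deg n (d i)" "h \<in> polys_deg n (d i)"
  shows "g i * (f * h) \<in> span (range q)"
proof -
  have "f * h \<in> polys_deg n (2 * d i)"
    using polys_deg_mult[OF assms(2,3)] by (simp add: mult_2)
  then show ?thesis
    unfolding q_basis(2) weighted_polys_def using i zero_in_polys_deg
    by (auto simp: sum_mult_if_eq
        intro!: exI[of _ "\<lambda>j. if j = i then f * h else 0"])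
qed

lemma basis_elem_in_polys_deg:
  assumes "i < m" "j < L i"
  shows "p i j \<in> polys_deg n (d i)"
  using basis_p[OF assms(1)] assms(2) span_base[of "p i j" "p i ` {..<L i}"]
  by (auto simp: basis_family_def)

lemma coeff_vec_sum:
  assumes "\<And>a. a \<in> A \<Longrightarrow> f a \<in> span (range q)"
  shows "coeff_vec q (\<Sum>a\<in>A. f a) = (\<Sum>a\<in>A. coeff_vec q (f a))"
  by (simp add: coeff_vec_def Finite_Cartesian_Product.vec_eq_iff representation_sum[OF q_basis(1) assms])

lemma coeff_vec_scaleR:
  assumes "f \<in> span (range q)"
  shows "coeff_vec q (c *\<^sub>R f) = c *\<^sub>R coeff_vec q f"
  by (simp add: coeff_vec_def Finite_Cartesian_Product.vec_eq_iff representation_scale[OF q_basis(1) assms])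

lemma coeff_vec_eq_0:
  assumes f: "f \<in> span (range q)" and "coeff_vec q f = 0"
  shows "f = 0"
proof -
  have "representation (range q) f b = 0" if "b \<in> range q" for b
    using assms(2) that by (auto simp: coeff_vec_def Finite_Cartesian_Product.vec_eq_iff)
  moreover have "(\<Sum>b\<in>range q. representation (range q) f b *\<^sub>R b) = f"
    using sum_representation_eq[OF q_basis(1) f, of "range q"] by simp
  ultimately show ?thesis by simp
qed

section \<open>The operators \<open>Lam\<close> and their pairing with the cone\<close>

lemma Lam_carrier: "\<Lambda> i y \<in> carrier_mat (L i) (L i)"
  by (simp add: Lam_def)

lemma Lam_entry:
  "j < L i \<Longrightarrow> k < L i \<Longrightarrow> \<Lambda> i y $$ (j, k) = inner (coeff_vec q (g i * p i j * p i k)) y"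
  by (simp add: Lam_def E_mat_def inner_vec_def mult.commute)

lemma Lam_symmetric: "transpose_mat (\<Lambda> i y) = \<Lambda> i y"
  by (rule eq_matI) (auto simp: Lam_carrier[THEN carrier_matD(1)] Lam_carrier[THEN carrier_matD(2)]
      Lam_entry mult_ac)

text \<open>The bridge between cone and matrices: the square is expanded in the basis
  \<open>p i\<close> and the coefficients are pulled out of \<open>coeff_vec\<close>, so that
  pairing \<open>y\<close> with a weighted square is evaluating a quadratic form.\<close>

lemma Lam_quadratic_form:
  assumes i: "i < m"
  shows "inner (coeff_vec q (g i * (\<Sum>j<L i. v j *\<^sub>R p i j)\<^sup>2)) y
    = (\<Sum>j<L i. \<Sum>k<L i. v j * \<Lambda> i y $$ (j, k) * v k)"
proof -
  have prod: "(c *\<^sub>R f) * h = c *\<^sub>R (f * h)" "f * (c *\<^sub>R h) = c *\<^sub>R (f * h)" for c and f h :: mpoly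
    by (simp_all add: scaleR_eq_single_mult mult_ac)
  have in_span: "g i * p i j * p i k \<in> span (range q)" if "j < L i" "k < L i" for j k
    using weighted_product_in_span[OF i basis_elem_in_polys_deg[OF i that(1)]
        basis_elem_in_polys_deg[OF i that(2)]] by (simp add: mult.assoc)
  have "g i * (\<Sum>j<L i. v j *\<^sub>R p i j)\<^sup>2
      = (\<Sum>j<L i. \<Sum>k<L i. (v j * v k) *\<^sub>R (g i * p i j * p i k))"
    unfolding power2_eq_square sum_product unfolding sum_distrib_left
    by (intro sum.cong refl) (simp add: prod mult.assoc)
  also have "coeff_vec q \<dots>
      = (\<Sum>j<L i. coeff_vec q (\<Sum>k<L i. (v j * v k) *\<^sub>R (g i * p i j * p i k)))"
    by (intro coeff_vec_sum span_sum span_scale in_span) auto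
  also have "\<dots> = (\<Sum>j<L i. \<Sum>k<L i. coeff_vec q ((v j * v k) *\<^sub>R (g i * p i j * p i k)))"
    by (intro sum.cong refl coeff_vec_sum span_scale in_span) auto
  also have "\<dots> = (\<Sum>j<L i. \<Sum>k<L i. (v j * v k) *\<^sub>R coeff_vec q (g i * p i j * p i k))"
    by (intro sum.cong refl coeff_vec_scaleR in_span) auto
  finally show ?thesis
    by (simp add: inner_sum_left Lam_entry mult_ac)
qed

lemma polys_deg_expansion:
  assumes i: "i < m" and f: "f \<in> polys_deg n (d i)"
  obtains v where "f = (\<Sum>j<L i. v j *\<^sub>R p i j)"
proof -
  have "inj_on (p i) {..<L i}" "f \<in> span (p i ` {..<L i})"
    using basis_p[OF i] f by (auto simp: basis_family_def)
  then obtain u where "f = (\<Sum>b\<in>p i ` {..<L i}. u b *\<^sub>R b)"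
    by (auto simp: span_finite)
  then have "f = (\<Sum>j<L i. u (p i j) *\<^sub>R p i j)"
    using \<open>inj_on (p i) {..<L i}\<close> by (simp add: sum.reindex)
  then show thesis by (rule that)
qed

lemma basis_combination:
  assumes i: "i < m" and v: "\<exists>j<L i. v j \<noteq> 0"
  shows "(\<Sum>j<L i. v j *\<^sub>R p i j) \<in> polys_deg n (d i)" "(\<Sum>j<L i. v j *\<^sub>R p i j) \<noteq> 0"
proof -
  have inj: "inj_on (p i) {..<L i}" and ind: "independent (p i ` {..<L i})"
    and span: "span (p i ` {..<L i}) = polys_deg n (d i)"
    using basis_p[OF i] by (auto simp: basis_family_def)
  show "(\<Sum>j<L i. v j *\<^sub>R p i j) \<in> polys_deg n (d i)"
    unfolding span[symmetric] by (intro span_sum span_scale span_base) auto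
  show "(\<Sum>j<L i. v j *\<^sub>R p i j) \<noteq> 0"
  proof
    assume 0: "(\<Sum>j<L i. v j *\<^sub>R p i j) = 0"
    \<comment> \<open>Independence concerns coefficients attached to basis elements, so the indexed
      family \<open>v\<close> is transported along the inverse of \<open>p i\<close>.\<close>
    define u where "u b = v (inv_into {..<L i} (p i) b)" for b
    have "(\<Sum>b\<in>p i ` {..<L i}. u b *\<^sub>R b) = 0"
      using inj 0 by (simp add: sum.reindex u_def)
    then have "u b = 0" if "b \<in> p i ` {..<L i}" for b
      using independentD[OF ind _ subset_refl _ that] by blast
    moreover obtain j where "j < L i" "v j \<noteq> 0" using v by blast
    ultimately have "u (p i j) = 0" by blast
    with \<open>j < L i\<close> \<open>v j \<noteq> 0\<close> show False using inv_into_f_f[OF inj, of j] by (auto simp: u_def)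
  qed
qed

lemma weighted_square_in_cone:
  assumes i: "i < m" and f: "f \<in> polys_deg n (d i)"
  shows "coeff_vec q (g i * f\<^sup>2) \<in> \<C>"
proof -
  have "f\<^sup>2 \<in> sos n (d i)"
    unfolding sos_def using f by (auto intro!: exI[of _ 1] exI[of _ "\<lambda>_. f"])
  moreover have "0 \<in> sos n r" for r
    unfolding sos_def by (auto intro!: exI[of _ 0])
  ultimately have "g i * f\<^sup>2 \<in> weighted_sos n m g d"
    unfolding weighted_sos_def using i
    by (auto simp: sum_mult_if_eq intro!: exI[of _ "\<lambda>j. if j = i then f\<^sup>2 else 0"])
  then show ?thesis by (simp add: sos_cone_def)
qed

text \<open>An interior point of the dual cone pairs strictly positively with every nonzero element
  of the cone. A weighted square of a nonzero polynomial is such an element: the product is nonzero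
  and coordinates are injective on the span.\<close>

lemma pos_def_Lam:
  assumes x: "x \<in> interior (dual_cone \<C>)" and i: "i < m"
  shows "pos_def_mat (L i) (\<Lambda> i x)"
proof -
  have "scalar_prod v (\<Lambda> i x *\<^sub>v v) > 0" if v: "v \<in> carrier_vec (L i)" "v \<noteq> 0\<^sub>v (L i)" for v
  proof -
    define f where "f = (\<Sum>j<L i. vec_index v j *\<^sub>R p i j)"
    have "\<exists>j<L i. vec_index v j \<noteq> 0" using v by (auto simp: Matrix.vec_eq_iff)
    note f = basis_combination[OF i this, folded f_def]
    define c where "c = coeff_vec q (g i * f\<^sup>2)"
    have "g i * f\<^sup>2 \<noteq> 0" using f(2) weight_nonzero[OF i] by simp
    then have c0: "c \<noteq> 0"
      using coeff_vec_eq_0[of "g i * f\<^sup>2"] weighted_product_in_span[OF i f(1) f(1)]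
      by (auto simp: c_def power2_eq_square)
    have c: "c \<in> \<C>" using weighted_square_in_cone[OF i f(1)] by (simp add: c_def)
    obtain e where e: "e > 0" "ball x e \<subseteq> dual_cone \<C>"
      using x by (auto simp: mem_interior)
    \<comment> \<open>A step of length \<open>e / 2\<close> from \<open>x\<close> against
      \<open>c\<close> stays in the dual cone, yet strictly lowers the pairing with
      \<open>c\<close>.\<close>
    define y where "y = x - (e / (2 * norm c)) *\<^sub>R c"
    have "y \<in> ball x e" using e(1) c0 by (simp add: y_def dist_norm)
    then have "inner c y \<ge> 0" using e(2) c by (auto simp: dual_cone_def)
    moreover have "inner c y = inner c x - e / (2 * norm c) * inner c c"
      by (simp add: y_def inner_diff_right)
    moreover have "e / (2 * norm c) * inner c c > 0" using e(1) c0 by simp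
    ultimately have "inner c x > 0" by linarith
    then show ?thesis
      using Lam_quadratic_form[OF i, of "vec_index v" x] v(1)
      by (simp add: c_def f_def scalar_prod_mult_mat_vec[OF Lam_carrier])
  qed
  then show ?thesis by (simp add: pos_def_mat_def Lam_carrier Lam_symmetric)
qed

text \<open>By the quadratic form identity such a \<open>y\<close> is orthogonal to all weighted
  squares and hence to the cone. A set with an interior point lies in no hyperplane.\<close>

lemma eq_0_if_Lam_eq_0:
  assumes s: "s \<in> interior \<C>" and y: "\<And>i. i < m \<Longrightarrow> \<Lambda> i y = 0\<^sub>m (L i) (L i)"
  shows "y = 0"
proof (rule ccontr)
  assume y0: "y \<noteq> 0"
  have ortho: "inner c y = 0" if "c \<in> \<C>" for c
  proof -
    from that obtain \<sigma> where \<sigma>: "\<And>i. i < m \<Longrightarrow> \<sigma> i \<in> sos n (d i)"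
      and c: "c = coeff_vec q (\<Sum>i<m. g i * \<sigma> i)"
      by (auto simp: sos_cone_def weighted_sos_def)
    have terms: "inner (coeff_vec q (g i * \<sigma> i)) y = 0 \<and> g i * \<sigma> i \<in> span (range q)" if i: "i < m" for i
    proof -
      from \<sigma>[OF i] obtain N :: nat and f where
        f: "\<And>k. k < N \<Longrightarrow> f k \<in> polys_deg n (d i)" and eq: "\<sigma> i = (\<Sum>k<N. (f k)\<^sup>2)"
        by (auto simp: sos_def)
      have in_span: "g i * (f k)\<^sup>2 \<in> span (range q)" if "k < N" for k
        using weighted_product_in_span[OF i f[OF that] f[OF that]] by (simp add: power2_eq_square)
      have "inner (coeff_vec q (g i * (f k)\<^sup>2)) y = 0" if k: "k < N" for k
      proof -
        from polys_deg_expansion[OF i f[OF k]] obtain v where "f k = (\<Sum>j<L i. v j *\<^sub>R p i j)" .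
        then show ?thesis using Lam_quadratic_form[OF i, of v y] y[OF i] by simp
      qed
      moreover have "coeff_vec q (g i * \<sigma> i) = (\<Sum>k<N. coeff_vec q (g i * (f k)\<^sup>2))"
        unfolding eq sum_distrib_left by (rule coeff_vec_sum) (simp add: in_span)
      moreover have "g i * \<sigma> i \<in> span (range q)"
        unfolding eq sum_distrib_left by (rule span_sum) (simp add: in_span)
      ultimately show ?thesis by (simp add: inner_sum_left)
    qed
    have "c = (\<Sum>i<m. coeff_vec q (g i * \<sigma> i))"
      unfolding c by (rule coeff_vec_sum) (use terms in simp)
    then show ?thesis using terms by (simp add: inner_sum_left)
  qed
  obtain e where e: "e > 0" "ball s e \<subseteq> \<C>" using s by (auto simp: mem_interior)
  \<comment> \<open>Both \<open>s\<close> and \<open>c\<close> lie in the cone and are orthogonal to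
    \<open>y\<close>, although they differ by a nonzero multiple of \<open>y\<close>.\<close>
  define c where "c = s + (e / (2 * norm y)) *\<^sub>R y"
  have "c \<in> ball s e" "s \<in> ball s e" using e(1) y0 by (simp_all add: c_def dist_norm)
  then have "inner c y = 0" "inner s y = 0" using e(2) ortho by blast+
  then show False using e(1) y0 by (simp add: c_def inner_add_left)
qed

lemma inner_Lam_adj: "inner (Lam_adj q (g i) (L i) (p i) X) y = frobenius (\<Lambda> i y) X"
proof -
  have "inner (Lam_adj q (g i) (L i) (p i) X) y
      = (\<Sum>u\<in>UNIV. \<Sum>j<L i. \<Sum>k<L i. y $ u * E_mat q (g i) (L i) (p i) u $$ (j, k) * X $$ (j, k))"
    by (simp add: inner_vec_def Lam_adj_def frobenius_def E_mat_def sum_distrib_left mult_ac)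
  also have "\<dots> = (\<Sum>j<L i. \<Sum>u\<in>UNIV. \<Sum>k<L i. y $ u * E_mat q (g i) (L i) (p i) u $$ (j, k) * X $$ (j, k))"
    by (rule sum.swap)
  also have "\<dots> = (\<Sum>j<L i. \<Sum>k<L i. \<Sum>u\<in>UNIV. y $ u * E_mat q (g i) (L i) (p i) u $$ (j, k) * X $$ (j, k))"
    by (intro sum.cong refl sum.swap)
  also have "\<dots> = frobenius (\<Lambda> i y) X"
    by (simp add: frobenius_def Lam_def sum_distrib_right)
  finally show ?thesis .
qed

end

subsection \<open>The barrier function\<close>

context sos_bases
begin

abbreviation "\<Lambda>adj i \<equiv> Lam_adj q (g i) (L i) (p i)"
abbreviation "F \<equiv> barrier m g L q p"

lemma pencil: "symmetric_pencil (L i) (\<Lambda> i)"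
proof (rule symmetric_pencil.intro)
  show "bounded_linear (\<lambda>x. \<Lambda> i x $$ (j, k))" if "j < L i" "k < L i" for j k
    unfolding Lam_entry[OF that] by (rule bounded_linear_inner_right)
qed (rule Lam_carrier, rule Lam_symmetric)

text \<open>With the entries of \<open>X\<close> as scalars in front of fixed vectors, entrywise
  derivatives of a matrix pass directly to its image under the adjoint.\<close>

lemma Lam_adj_eq_sum:
  assumes "X \<in> carrier_mat (L i) (L i)"
  shows "\<Lambda>adj i X = (\<Sum>j<L i. \<Sum>k<L i. X $$ (j, k) *\<^sub>R (\<chi> u. E_mat q (g i) (L i) (p i) u $$ (j, k)))"
  by (simp add: Lam_adj_def Finite_Cartesian_Product.vec_eq_iff frobenius_def E_mat_def mult.commute)

text \<open>The assumption is positivity of the determinants because this describes an open set on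
  which the formula holds throughout, as a second differentiation requires.\<close>

lemma barrier_gderiv:
  assumes y: "\<And>i. i < m \<Longrightarrow> Determinant.det (\<Lambda> i y) > 0"
  shows "GDERIV F y :> - (\<Sum>i<m. \<Lambda>adj i (inv_mat (\<Lambda> i y)))"
proof -
  have "((\<lambda>z. ln (Determinant.det (\<Lambda> i z))) has_derivative
      (\<lambda>h. frobenius (\<Lambda> i h) (inv_mat (\<Lambda> i y)))) (at y)" if i: "i < m" for i
  proof -
    have "((\<lambda>z. ln (Determinant.det (\<Lambda> i z))) has_derivative
        (\<lambda>h. Determinant.det (\<Lambda> i y) * frobenius (\<Lambda> i h) (inv_mat (\<Lambda> i y))
          * inverse (Determinant.det (\<Lambda> i y)))) (at y)"
      using y[OF i]
      by (intro has_derivative_ln symmetric_pencil.det_has_derivative_inv[OF pencil]) auto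
    then show ?thesis using y[OF i] by (simp add: field_simps)
  qed
  then have "(F has_derivative (\<lambda>h. - (\<Sum>i<m. frobenius (\<Lambda> i h) (inv_mat (\<Lambda> i y))))) (at y)"
    unfolding barrier_def by (intro has_derivative_minus has_derivative_sum) auto
  then show ?thesis
    by (simp add: gderiv_def inner_sum_right inner_Lam_adj[symmetric] inner_commute)
qed

lemma gradient_barrier:
  assumes "\<And>i. i < m \<Longrightarrow> Determinant.det (\<Lambda> i y) > 0"
  shows "gradient F y = - (\<Sum>i<m. \<Lambda>adj i (inv_mat (\<Lambda> i y)))"
  using barrier_gderiv[OF assms] by (rule gradient_eqI)

text \<open>The gradient formula is differentiated on the open set \<open>?U\<close>; its minus sign
  cancels the one from the derivative of the inverse.\<close>

lemma hessian_barrier: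
  assumes x: "\<And>i. i < m \<Longrightarrow> pos_def_mat (L i) (\<Lambda> i x)"
  shows "hessian F x *v h
    = (\<Sum>i<m. \<Lambda>adj i (inv_mat (\<Lambda> i x) * \<Lambda> i h * inv_mat (\<Lambda> i x)))"
proof -
  let ?D = "\<lambda>h. \<Sum>i<m. \<Lambda>adj i (inv_mat (\<Lambda> i x) * \<Lambda> i h * inv_mat (\<Lambda> i x))"
  let ?E = "\<lambda>i j k. (\<chi> u. E_mat q (g i) (L i) (p i) u $$ (j, k)) :: real ^ 'u"
  let ?U = "\<Inter>i<m. {z. Determinant.det (\<Lambda> i z) > 0}"
  note det_pos = pos_def_mat_det_pos[OF x]
  note N = inv_mat_pos_def[OF x]
  have NN: "inv_mat (\<Lambda> i x) * \<Lambda> i h * inv_mat (\<Lambda> i x) \<in> carrier_mat (L i) (L i)"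
    if "i < m" for i h
    using N(1)[OF that] Lam_carrier by (intro mult_carrier_mat)
  have U: "open ?U"
    by (intro open_INT) (auto intro: symmetric_pencil.open_det_pos[OF pencil])
  have "((\<lambda>z. - (\<Sum>i<m. \<Sum>j<L i. \<Sum>k<L i. inv_mat (\<Lambda> i z) $$ (j, k) *\<^sub>R ?E i j k)) has_derivative
      (\<lambda>h. - (\<Sum>i<m. \<Sum>j<L i. \<Sum>k<L i.
        (- (inv_mat (\<Lambda> i x) * \<Lambda> i h * inv_mat (\<Lambda> i x)) $$ (j, k)) *\<^sub>R ?E i j k))) (at x)"
    by (intro has_derivative_minus has_derivative_sum has_derivative_scaleR_left
        symmetric_pencil.inv_entry_has_derivative[OF pencil] det_pos) auto
  also have "(\<lambda>h. - (\<Sum>i<m. \<Sum>j<L i. \<Sum>k<L i.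
        (- (inv_mat (\<Lambda> i x) * \<Lambda> i h * inv_mat (\<Lambda> i x)) $$ (j, k)) *\<^sub>R ?E i j k)) = ?D"
    by (simp add: Lam_adj_eq_sum[OF NN] sum_negf fun_eq_iff del: index_mult_mat(1) assoc_mult_mat)
  finally have "(gradient F has_derivative ?D) (at x)"
  proof (rule has_derivative_transform_within_open[OF _ U])
    show "x \<in> ?U" using det_pos by auto
    fix z assume "z \<in> ?U"
    then have z: "\<And>i. i < m \<Longrightarrow> Determinant.det (\<Lambda> i z) > 0" by auto
    then have "inv_mat (\<Lambda> i z) \<in> carrier_mat (L i) (L i)" if "i < m" for i
      using that mat_inverse_mult(1)[OF Lam_carrier] by (metis less_numeral_extra(3))
    then show "- (\<Sum>i<m. \<Sum>j<L i. \<Sum>k<L i. inv_mat (\<Lambda> i z) $$ (j, k) *\<^sub>R ?E i j k) = gradient F z"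
      by (simp add: gradient_barrier z Lam_adj_eq_sum)
  qed
  then have "frechet_derivative (gradient F) (at x) = ?D" and "linear ?D"
    by (simp_all add: frechet_derivative_at[symmetric] has_derivative_linear)
  then show ?thesis
    by (simp add: hessian_def matrix_works linear_matrix_vector_mul_eq)
qed

lemma inner_hessian_barrier:
  assumes "\<And>i. i < m \<Longrightarrow> pos_def_mat (L i) (\<Lambda> i x)"
  shows "inner (hessian F x *v u) v
    = (\<Sum>i<m. frobenius (\<Lambda> i v) (inv_mat (\<Lambda> i x) * \<Lambda> i u * inv_mat (\<Lambda> i x)))"
  by (simp add: hessian_barrier assms inner_sum_left inner_Lam_adj)

text \<open>The quadratic form is a sum of nonnegative terms. On a kernel vector every term
  vanishes, so each \<open>\<Lambda> i v\<close> is zero, and the interior point \<open>s\<close> of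
  the cone forces \<open>v = 0\<close>.\<close>

lemma hessian_barrier_pos_def:
  assumes x: "\<And>i. i < m \<Longrightarrow> pos_def_mat (L i) (\<Lambda> i x)" and s: "s \<in> interior \<C>"
  shows "pos_semidef (hessian F x)" "invertible (hessian F x)"
proof -
  have nonneg: "frobenius (\<Lambda> i v) (inv_mat (\<Lambda> i x) * \<Lambda> i v * inv_mat (\<Lambda> i x)) \<ge> 0"
    if "i < m" for i v
    using frobenius_inv_congruence_nonneg[OF x[OF that] Lam_carrier] .
  show "pos_semidef (hessian F x)"
    unfolding pos_semidef_def
  proof (intro conjI allI inner_symmetric_imp_transpose_eq)
    show "inner (hessian F x *v u) v = inner u (hessian F x *v v)" for u v
    proof -
      have "inner (hessian F x *v u) v = inner (hessian F x *v v) u"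
        by (simp add: inner_hessian_barrier x frobenius_inv_congruence_commute[OF x Lam_carrier Lam_carrier])
      then show ?thesis by (simp add: inner_commute)
    qed
    have "inner (hessian F x *v v) v \<ge> 0" for v
    proof -
      have "0 \<le> (\<Sum>i<m. frobenius (\<Lambda> i v) (inv_mat (\<Lambda> i x) * \<Lambda> i v * inv_mat (\<Lambda> i x)))"
        by (rule sum_nonneg) (rule nonneg, simp)
      then show ?thesis by (simp add: inner_hessian_barrier x)
    qed
    then show "inner v (hessian F x *v v) \<ge> 0" for v
      by (simp add: inner_commute)
  qed
  have "v = 0" if "hessian F x *v v = 0" for v
  proof (rule eq_0_if_Lam_eq_0[OF s])
    fix i assume i: "i < m"
    have "(\<Sum>i<m. frobenius (\<Lambda> i v) (inv_mat (\<Lambda> i x) * \<Lambda> i v * inv_mat (\<Lambda> i x))) = 0"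
      using inner_hessian_barrier[of x v v] x that by simp
    then have "frobenius (\<Lambda> i v) (inv_mat (\<Lambda> i x) * \<Lambda> i v * inv_mat (\<Lambda> i x)) = 0"
      using i nonneg by (subst (asm) sum_nonneg_eq_0_iff) auto
    then show "\<Lambda> i v = 0\<^sub>m (L i) (L i)"
      by (rule frobenius_inv_congruence_eq_0[OF x[OF i] Lam_carrier])
  qed
  then show "invertible (hessian F x)"
    unfolding invertible_left_inverse matrix_left_invertible_ker by blast
qed

end

section \<open>Recovery of \<open>s\<close> from the matrices \<open>S i\<close>, and their positive
  definiteness\<close>

theorem theorem6p3:
  fixes n m :: nat
    and g :: "nat \<Rightarrow> mpoly"
    and d L :: "nat \<Rightarrow> nat"
    and q :: "'u::finite \<Rightarrow> mpoly"
    and p :: "nat \<Rightarrow> nat \<Rightarrow> mpoly"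
    and x s w :: "real ^ 'u"
    and F :: "real ^ 'u \<Rightarrow> real"
    and H :: "real ^ 'u ^ 'u"
    and S :: "nat \<Rightarrow> real mat"
  assumes g: "\<And>i. i < m \<Longrightarrow> g i \<in> polys n \<and> g i \<noteq> 0"
    and L: "\<And>i. i < m \<Longrightarrow> L i = dim (polys_deg n (d i))"
    and q: "basis_family UNIV q (weighted_polys n m g d)"
    and p: "\<And>i. i < m \<Longrightarrow> basis_family {..<L i} (p i) (polys_deg n (d i))"
    and F: "F = barrier m g L q p"
    and H: "H = hessian F x"
    and x: "x \<in> interior (dual_cone (sos_cone n m g d q))"
    and s: "s \<in> interior (sos_cone n m g d q)"
    and w: "w = matrix_inv H *v s"
    and S: "\<And>i. i < m \<Longrightarrow> S i = inv_mat (Lam q (g i) (L i) (p i) x)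
               * Lam q (g i) (L i) (p i) w * inv_mat (Lam q (g i) (L i) (p i) x)"
  shows "(\<Sum>i<m. Lam_adj q (g i) (L i) (p i) (S i)) = s
    \<and> ((\<exists>\<delta>>0. norm (matrix_sqrt (matrix_inv H) *v (s + \<delta> *\<^sub>R gradient F x)) < \<delta>)
         \<longrightarrow> (\<forall>i<m. pos_def_mat (L i) (S i)))"
proof -
  interpret sos_bases n m g d L q p
    using g q p by unfold_locales auto
  have pd: "pos_def_mat (L i) (\<Lambda> i x)" if "i < m" for i
    using pos_def_Lam[OF x that] .
  note N = inv_mat_pos_def[OF pd]
  have psd: "pos_semidef H" and inv: "invertible H"
    unfolding H F using hessian_barrier_pos_def[of x s] pd s by blast+
  have Hw: "H *v w = s" unfolding w by (rule matrix_inv_invertible(1)[OF inv])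
  have part1: "(\<Sum>i<m. \<Lambda>adj i (S i)) = s"
    using Hw by (simp add: H F hessian_barrier pd S del: assoc_mult_mat)
  \<comment> \<open>An identity of logarithmic homogeneity: for the direction \<open>x\<close>
    itself, the product of inverse, matrix and inverse collapses to the inverse.\<close>
  have Hx: "H *v x = - gradient F x"
  proof -
    have "H *v x = (\<Sum>i<m. \<Lambda>adj i (inv_mat (\<Lambda> i x) * \<Lambda> i x * inv_mat (\<Lambda> i x)))"
      unfolding H F by (rule hessian_barrier) (rule pd)
    also have "\<dots> = (\<Sum>i<m. \<Lambda>adj i (inv_mat (\<Lambda> i x)))"
      by (simp add: N(3) left_mult_one_mat[OF N(1)] del: assoc_mult_mat)
    finally show ?thesis
      unfolding F by (simp add: gradient_barrier pos_def_mat_det_pos[OF pd])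
  qed
  have "pos_def_mat (L i) (S i)"
    if \<delta>: "\<delta> > 0" and small: "norm (matrix_sqrt (matrix_inv H) *v (s + \<delta> *\<^sub>R gradient F x)) < \<delta>"
      and i: "i < m" for \<delta> i
  proof -
    define y where "y = w - \<delta> *\<^sub>R x"
    let ?f = "\<lambda>i. frobenius (\<Lambda> i y) (inv_mat (\<Lambda> i x) * \<Lambda> i y * inv_mat (\<Lambda> i x))"
    have Hy: "H *v y = s + \<delta> *\<^sub>R gradient F x"
      by (simp add: y_def matrix_vector_mult_diff_distrib matrix_vector_mult_scaleR Hw Hx)
    \<comment> \<open>All summands are nonnegative, so one bound on the total controls every index
      \<open>i\<close>.\<close>
    have "?f i \<le> (\<Sum>i<m. ?f i)"
      using i by (intro member_le_sum frobenius_inv_congruence_nonneg[OF pd Lam_carrier]) auto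
    also have "\<dots> = inner (H *v y) y"
      unfolding H F by (rule inner_hessian_barrier[symmetric]) (rule pd)
    \<comment> \<open>The quadratic form of the inverse Hessian at \<open>H *v y\<close> is the form
      of \<open>H\<close> at \<open>y\<close>.\<close>
    also have "\<dots> = (norm (matrix_sqrt (matrix_inv H) *v (H *v y)))\<^sup>2"
      by (simp add: norm_matrix_sqrt[OF pos_semidef_matrix_inv[OF psd inv]]
          matrix_inv_invertible[OF inv])
    also have "\<dots> < \<delta>\<^sup>2"
      using small unfolding Hy by (intro power_strict_mono) auto
    finally have "?f i < \<delta>\<^sup>2" .
    moreover have "\<Lambda> i y = \<Lambda> i w - \<delta> \<cdot>\<^sub>m \<Lambda> i x"
      by (simp add: y_def symmetric_pencil.diff[OF pencil] symmetric_pencil.scaleR[OF pencil])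
    ultimately show ?thesis
      unfolding S[OF i] using pos_def_mat_inv_congruence[OF pd[OF i] Lam_carrier Lam_symmetric \<delta>]
      by blast
  qed
  with part1 show ?thesis by blast
qed

end
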